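(* Let $n\ge1$, let $\mathcal{H}\subset\mathbb{R}^{n+1}$ be a Euclidean complete connected hyperbolic centroaffine hypersurface and let $U:=\mathbb{R}^{>0}\cdot\mathcal{H}$. Then the cone $U$ is open and convex, and the map $\phi:\mathbb{R}^{>0}\times\mathcal{H}\to U$ given by $(\lambda,x)\mapsto\lambda x$ is a diffeomorphism.
   Context: Let $\tilde\nabla$ be the canonical flat connection on $\mathbb{R}^{n+1}$ and $\xi$ the position vector field. A smooth embedded hypersurface $\mathcal{H}\subset\mathbb{R}^{n+1}$ is centroaffine if $x\notin T_x\mathcal{H}$ for all $x\in\mathcal{H}$; its centroaffine metric $g$ is determined by $\tilde\nabla_XY=\nabla_XY+g(X,Y)\xi$ for $X,Y$ tangent to $\mathcal{H}$, with $\nabla_XY$ tangent to $\mathcal{H}$. It is hyperbolic if $g$ is positive definite, and Euclidean complete if it is complete for the Riemannian metric induced by the Euclidean scalar product. *)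

theory Defs
  imports "HOL-Analysis.Analysis"
begin

section \<open>Smooth maps\<close>

text \<open>
  \<open>Ck_on k S f\<close> is used for open \<open>S\<close> only. In finite dimension, \<open>f\<close> is \<open>C\<^sup>k\<^sup>+\<^sup>1\<close> on \<open>S\<close> if and
  only if it is differentiable on \<open>S\<close> and all its directional derivatives are \<open>C\<^sup>k\<close> on \<open>S\<close>.
\<close>

primrec Ck_on :: "nat \<Rightarrow> 'a::euclidean_space set \<Rightarrow> ('a \<Rightarrow> 'b::euclidean_space) \<Rightarrow> bool" where
  "Ck_on 0 S f \<longleftrightarrow> continuous_on S f"
| "Ck_on (Suc k) S f \<longleftrightarrow>
     (\<forall>x\<in>S. f differentiable (at x)) \<and> (\<forall>v. Ck_on k S (\<lambda>x. frechet_derivative f (at x) v))"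

text \<open>
  Smoothness on an arbitrary subset of a Euclidean space means that local smooth extensions
  exist. On an open set this is ordinary smoothness, on an embedded submanifold it is smoothness
  in the sense of manifolds.
\<close>

definition smooth_on :: "'a::euclidean_space set \<Rightarrow> ('a \<Rightarrow> 'b::euclidean_space) \<Rightarrow> bool" where
  "smooth_on A f \<longleftrightarrow>
     (\<forall>a\<in>A. \<exists>V F. open V \<and> a \<in> V \<and> (\<forall>k. Ck_on k V F) \<and> (\<forall>x\<in>V \<inter> A. F x = f x))"

definition diffeomorphism_on ::
  "'a::euclidean_space set \<Rightarrow> 'b::euclidean_space set \<Rightarrow> ('a \<Rightarrow> 'b) \<Rightarrow> bool" where
  "diffeomorphism_on A B f \<longleftrightarrow> bij_betw f A B \<and> smooth_on A f \<and> smooth_on B (inv_into A f)"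


section \<open>Embedded hypersurfaces\<close>

text \<open>Slice charts; the hyperplane may be any hyperplane through the origin.\<close>

definition embedded_hypersurface :: "'a::euclidean_space set \<Rightarrow> bool" where
  "embedded_hypersurface H \<longleftrightarrow>
     (\<forall>p\<in>H. \<exists>V (W::'a set) (\<psi>::'a \<Rightarrow> 'a) a. open V \<and> p \<in> V \<and> open W \<and> diffeomorphism_on V W \<psi> \<and> a \<noteq> 0 \<and>
        \<psi> ` (V \<inter> H) = W \<inter> {y. a \<bullet> y = 0})"

definition tangent_space :: "'a::euclidean_space set \<Rightarrow> 'a \<Rightarrow> 'a set" where
  "tangent_space H p =
     {v. \<exists>\<gamma> \<epsilon>. 0 < \<epsilon> \<and> smooth_on {-\<epsilon><..<\<epsilon>} \<gamma> \<and> \<gamma> ` {-\<epsilon><..<\<epsilon>} \<subseteq> H \<and> \<gamma> 0 = p \<and>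
        (\<gamma> has_vector_derivative v) (at (0::real))}"


section \<open>Centroaffine hypersurfaces\<close>

definition centroaffine_hypersurface :: "'a::euclidean_space set \<Rightarrow> bool" where
  "centroaffine_hypersurface H \<longleftrightarrow> embedded_hypersurface H \<and> (\<forall>x\<in>H. x \<notin> tangent_space H x)"

definition flat_connection ::
  "('a::euclidean_space \<Rightarrow> 'a) \<Rightarrow> ('a \<Rightarrow> 'a) \<Rightarrow> 'a \<Rightarrow> 'a" where
  "flat_connection X Y p = frechet_derivative Y (at p) (X p)"

text \<open>
  A vector field on an open part \<open>V \<inter> H\<close> of \<open>H\<close> that is tangent to \<open>H\<close>, given together with a
  smooth extension to the open set \<open>V\<close> of the ambient space. Locally every smooth tangent vector
  field arises in this way. At points of \<open>H\<close>, the flat derivative along a tangent vector does not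
  depend on the extension.
\<close>

definition tangent_field :: "'a::euclidean_space set \<Rightarrow> 'a set \<Rightarrow> ('a \<Rightarrow> 'a) \<Rightarrow> bool" where
  "tangent_field H V X \<longleftrightarrow> smooth_on V X \<and> (\<forall>q\<in>V \<inter> H. X q \<in> tangent_space H q)"

text \<open>
  The Gauss formula, where \<open>Z\<close> is the value at \<open>p\<close> of the tangential part and the position vector
  field has the value \<open>p\<close> at \<open>p\<close>. On a centroaffine hypersurface it determines \<open>g p u v\<close> for
  all \<open>p \<in> H\<close> and all \<open>u\<close>, \<open>v\<close> tangent to \<open>H\<close> at \<open>p\<close>; the other values of \<open>g\<close> are irrelevant.
\<close>

definition is_centroaffine_metric ::
  "'a::euclidean_space set \<Rightarrow> ('a \<Rightarrow> 'a \<Rightarrow> 'a \<Rightarrow> real) \<Rightarrow> bool" where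
  "is_centroaffine_metric H g \<longleftrightarrow>
     (\<forall>V X Y. open V \<longrightarrow> tangent_field H V X \<longrightarrow> tangent_field H V Y \<longrightarrow>
        (\<forall>p\<in>V \<inter> H. \<exists>Z\<in>tangent_space H p.
           flat_connection X Y p = Z + g p (X p) (Y p) *\<^sub>R p))"

definition hyperbolic_centroaffine_hypersurface :: "'a::euclidean_space set \<Rightarrow> bool" where
  "hyperbolic_centroaffine_hypersurface H \<longleftrightarrow>
     centroaffine_hypersurface H \<and>
     (\<exists>g. is_centroaffine_metric H g \<and> (\<forall>p\<in>H. \<forall>v\<in>tangent_space H p. v \<noteq> 0 \<longrightarrow> 0 < g p v v))"


section \<open>Euclidean completeness\<close>

text \<open>
  Paths are piecewise \<open>C\<^sup>1\<close>. Since \<^const>\<open>valid_path\<close> admits unbounded derivatives near the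
  exceptional points, a path can have infinite length. The length is therefore an extended
  nonnegative real; the Henstock-Kurzweil integral would assign length \<open>0\<close> to such paths.
\<close>

definition path_length :: "(real \<Rightarrow> 'a::euclidean_space) \<Rightarrow> ennreal" where
  "path_length \<gamma> = (\<integral>\<^sup>+ t\<in>{0..1}. ennreal (norm (vector_derivative \<gamma> (at t))) \<partial>lborel)"

definition induced_dist :: "'a::euclidean_space set \<Rightarrow> 'a \<Rightarrow> 'a \<Rightarrow> ennreal" where
  "induced_dist H x y =
     (INF \<gamma>\<in>{\<gamma>. valid_path \<gamma> \<and> path_image \<gamma> \<subseteq> H \<and> pathstart \<gamma> = x \<and> pathfinish \<gamma> = y}.
        path_length \<gamma>)"

text \<open>
  Every Cauchy sequence for the Riemannian distance of the metric induced by the Euclidean scalar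
  product converges in \<open>H\<close> with respect to this distance.
\<close>

definition euclidean_complete :: "'a::euclidean_space set \<Rightarrow> bool" where
  "euclidean_complete H \<longleftrightarrow>
     (\<forall>\<sigma>::nat \<Rightarrow> 'a. range \<sigma> \<subseteq> H \<longrightarrow>
        (\<forall>\<epsilon>>0. \<exists>N. \<forall>i\<ge>N. \<forall>j\<ge>N. induced_dist H (\<sigma> i) (\<sigma> j) < \<epsilon>) \<longrightarrow>
        (\<exists>x\<in>H. (\<lambda>i. induced_dist H (\<sigma> i) x) \<longlonglongrightarrow> 0))"


section \<open>The cone over a hypersurface\<close>

definition cone_over :: "'a::euclidean_space set \<Rightarrow> 'a set" where
  "cone_over H = {r *\<^sub>R x | r x. (0::real) < r \<and> x \<in> H}"

end

theory Submission
  imports Defs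
begin

text \<open>
  The cone map \<open>(r, x) \<mapsto> r x\<close> is a local diffeomorphism because the position vector is transversal
  to \<open>H\<close>; hence the cone is open, and all that is in doubt is injectivity of the map and convexity of
  the cone. Both follow from one statement: for any two points \<open>x\<close>, \<open>y\<close> of \<open>H\<close> the segment from \<open>x\<close>
  to \<open>y\<close> lifts through the cone map to a curve in \<open>{0<..} \<times> H\<close> that starts at \<open>(1, x)\<close> and ends at
  \<open>(1, y)\<close>. A lift over the segment keeps the segment in the cone, which is convexity. If \<open>y = c x\<close>
  with \<open>c > 0\<close>, the ray through \<open>x\<close> has the obvious lift \<open>u x \<mapsto> (u, x)\<close>, lifts are unique, so
  \<open>c = 1\<close>; this is injectivity.

  A lift over a set \<open>S\<close> is given by its first component, a positive continuous function \<open>\<Psi>\<close> on \<open>S\<close> with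
  \<open>q / \<Psi> q \<in> H\<close> (\<open>radial_section\<close>). Over open sets such a function is smooth and locally
  homogeneous of degree one, and near a point of \<open>H\<close> where \<open>\<Psi> = 1\<close>, \<open>H\<close> is the level set
  \<open>{\<Psi> = 1}\<close>. The Gauss formula for the field
  \<open>X q = w - (d\<Psi>\<^sub>q w / \<Psi> q) q\<close> gives \<open>g (X, X) = - D\<^sup>2\<Psi> (w, w)\<close> at points of \<open>H\<close>, so hyperbolicity says
  that \<open>\<Psi>\<close> is concave along segments (\<open>radial_graph_hessian\<close>).

  The existence of the lift is a continuity argument. Fix \<open>x\<close>. The germ of the section at \<open>x\<close> with value
  1 extends to a maximal section \<open>\<Phi>\<close> on an open set \<open>L\<close> that is starlike about \<open>x\<close>. The set
  \<open>A = {y \<in> H \<inter> L. \<Phi> y = 1}\<close> contains \<open>x\<close> and is open in \<open>H\<close>; since \<open>H\<close> is connected, it suffices that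
  \<open>A\<close> is closed in \<open>H\<close>. Let points \<open>z \<in> A\<close> converge to \<open>y \<in> H\<close>. By concavity, \<open>\<Phi> \<ge> 1\<close> on the segment from
  \<open>x\<close> to \<open>z\<close>, and its slope there lies between the slope at \<open>z\<close> and the slope at \<open>x\<close>. The slope at \<open>z\<close> can
  be computed from the local section of \<open>H\<close> near \<open>y\<close>, so both stay bounded as \<open>z\<close> tends to \<open>y\<close>. These
  bounds pass to the part of the segment from \<open>x\<close> to \<open>y\<close> that lies in \<open>L\<close>. There the curve \<open>q / \<Phi> q\<close> in
  \<open>H\<close> therefore has bounded speed, and Euclidean completeness provides a limit point in \<open>H\<close>. Around
  this limit point a local section exists and continues \<open>\<Phi>\<close>, so the segment cannot leave \<open>L\<close>
  (\<open>radial_section_reaches_limit\<close>); hence \<open>y \<in> L\<close>, and \<open>\<Phi> y = 1\<close> by continuity.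
\<close>

section \<open>Calculus of differentiability classes\<close>

lemma Ck_on_subset: "Ck_on k S f \<Longrightarrow> T \<subseteq> S \<Longrightarrow> Ck_on k T f"
  by (induction k arbitrary: f) (auto intro: continuous_on_subset)

lemma Ck_on_has_derivative:
  assumes "Ck_on (Suc k) S f" "x \<in> S"
  shows "(f has_derivative frechet_derivative f (at x)) (at x)"
  using assms unfolding frechet_derivative_works[symmetric] by simp

lemma Ck_on_differentiable: "Ck_on (Suc k) S f \<Longrightarrow> x \<in> S \<Longrightarrow> f differentiable (at x)"
  by simp

lemma Ck_on_deriv: "Ck_on (Suc k) S f \<Longrightarrow> Ck_on k S (\<lambda>x. frechet_derivative f (at x) v)"
  unfolding Ck_on.simps by (elim conjE allE)

text \<open>
  On open sets both the function and its derivatives depend only on local values, which is what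
  allows modifying a function outside the set of interest.
\<close>

lemma Ck_on_cong:
  assumes "open S" "\<And>x. x \<in> S \<Longrightarrow> f x = g x" "Ck_on k S f"
  shows "Ck_on k S g"
  using assms(2,3)
proof (induction k arbitrary: f g)
  case 0
  then show ?case by (metis Ck_on.simps(1) continuous_on_cong)
next
  case (Suc k)
  have g: "(g has_derivative frechet_derivative f (at x)) (at x)" if "x \<in> S" for x
    by (rule has_derivative_transform_within_open[OF Ck_on_has_derivative[OF Suc.prems(2) that]
          \<open>open S\<close> that Suc.prems(1)])
  then have "frechet_derivative f (at x) = frechet_derivative g (at x)" if "x \<in> S" for x
    using that by (auto intro: frechet_derivative_at)
  then show ?case
    using Suc.prems(2) Suc.IH[of "\<lambda>x. frechet_derivative f (at x) v" "\<lambda>x. frechet_derivative g (at x) v" for v] g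
    by (auto intro: differentiableI)
qed

lemma Ck_on_continuous: "Ck_on k S f \<Longrightarrow> continuous_on S f"
  by (cases k)
     (auto intro!: continuous_at_imp_continuous_on differentiable_imp_continuous_within)

lemma Ck_on_SucD: "Ck_on (Suc k) S f \<Longrightarrow> Ck_on k S f"
proof (induction k arbitrary: f)
  case 0
  then show ?case using Ck_on_continuous[of "Suc 0" S f] by simp
next
  case (Suc k)
  show ?case
    unfolding Ck_on.simps(2)[of k]
    by (intro conjI ballI allI Ck_on_differentiable[OF Suc.prems] Suc.IH Ck_on_deriv[OF Suc.prems])
qed

lemma Ck_on_SucI:
  assumes "open S" "\<And>x. x \<in> S \<Longrightarrow> (f has_derivative f' x) (at x)"
    and "\<And>v. Ck_on k S (\<lambda>x. f' x v)"
  shows "Ck_on (Suc k) S f"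
proof -
  have "f' x = frechet_derivative f (at x)" if "x \<in> S" for x
    using assms(2)[OF that] by (rule frechet_derivative_at)
  then have "Ck_on k S (\<lambda>x. frechet_derivative f (at x) v)" for v
    by (intro Ck_on_cong[OF assms(1) _ assms(3)[of v]]) auto
  then show ?thesis using assms(2) by (auto intro: differentiableI)
qed

lemma Ck_on_local:
  assumes "\<And>x. x \<in> S \<Longrightarrow> \<exists>V. open V \<and> x \<in> V \<and> Ck_on k V f"
  shows "Ck_on k S f"
  using assms
proof (induction k arbitrary: f)
  case 0
  show ?case
    unfolding Ck_on.simps
  proof (intro continuous_at_imp_continuous_on ballI)
    fix x assume "x \<in> S"
    then show "isCont f x"
      using 0 continuous_on_eq_continuous_at by fastforce
  qed
next
  case (Suc k)
  have "f differentiable at x" if x: "x \<in> S" for x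
  proof -
    obtain V where "x \<in> V" "Ck_on (Suc k) V f" using Suc.prems[OF x] by (elim exE conjE)
    then show ?thesis by (rule Ck_on_differentiable[rotated])
  qed
  moreover have "Ck_on k S (\<lambda>x. frechet_derivative f (at x) v)" for v
  proof (rule Suc.IH)
    fix x assume x: "x \<in> S"
    obtain V where "open V" "x \<in> V" "Ck_on (Suc k) V f" using Suc.prems[OF x] by (elim exE conjE)
    then show "\<exists>V. open V \<and> x \<in> V \<and> Ck_on k V (\<lambda>x. frechet_derivative f (at x) v)"
      by (intro exI[of _ V] conjI Ck_on_deriv)
  qed
  ultimately show ?case by simp
qed

text \<open>
  Being \<open>C\<^sup>k\<close> is local, so over an open set the local extensions in the definition of smoothness can
  be replaced by the function itself.
\<close>

lemma smooth_on_open: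
  assumes "open S"
  shows "smooth_on S f \<longleftrightarrow> (\<forall>k. Ck_on k S f)"
proof
  assume f: "smooth_on S f"
  have "\<exists>V. open V \<and> x \<in> V \<and> Ck_on k V f" if x: "x \<in> S" for x k
  proof -
    obtain V F where "open V" "x \<in> V" "\<forall>k. Ck_on k V F" and F: "\<forall>x\<in>V \<inter> S. F x = f x"
      using f x unfolding smooth_on_def by blast
    then have "Ck_on k (V \<inter> S) F" by (auto intro: Ck_on_subset)
    then have "Ck_on k (V \<inter> S) f"
      using F \<open>open V\<close> assms by (intro Ck_on_cong[of "V \<inter> S" F f]) auto
    then show ?thesis using \<open>open V\<close> \<open>x \<in> V\<close> x assms by (intro exI[of _ "V \<inter> S"]) auto
  qed
  then show "\<forall>k. Ck_on k S f" by (intro allI Ck_on_local)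
next
  assume "\<forall>k. Ck_on k S f"
  then show "smooth_on S f"
    unfolding smooth_on_def using assms by (intro ballI exI[of _ S] exI[of _ f]) simp
qed

text \<open>
  The defining equation would make the simplifier unfold every class \<open>C\<^sup>k\<^sup>+\<^sup>1\<close> into a quantified statement
  about directional derivatives.
\<close>

declare Ck_on.simps(2) [simp del]

lemma Ck_on_const: "Ck_on k S (\<lambda>x. c)"
  by (induction k arbitrary: c) (auto simp: Ck_on.simps(2))

lemma Ck_on_linear:
  assumes "bounded_linear f"
  shows "Ck_on k S f"
proof (cases k)
  case 0
  then show ?thesis using assms by (simp add: linear_continuous_on)
next
  case (Suc m)
  have "frechet_derivative f (at x) = f" for x
    using frechet_derivative_at[OF bounded_linear.has_derivative[OF assms has_derivative_ident]]
    by simp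
  then show ?thesis
    using Suc assms by (simp add: Ck_on.simps(2) Ck_on_const bounded_linear_imp_differentiable)
qed

lemma Ck_on_add:
  assumes "open S" "Ck_on k S f" "Ck_on k S g"
  shows "Ck_on k S (\<lambda>x. f x + g x)"
  using assms(2,3)
proof (induction k arbitrary: f g)
  case 0
  then show ?case by (simp add: continuous_on_add)
next
  case (Suc k)
  show ?case
  proof (rule Ck_on_SucI[OF \<open>open S\<close>])
    show "((\<lambda>x. f x + g x) has_derivative
        (\<lambda>v. frechet_derivative f (at x) v + frechet_derivative g (at x) v)) (at x)" if "x \<in> S" for x
      using Suc.prems that by (intro has_derivative_add Ck_on_has_derivative)
  qed (intro Suc.IH Ck_on_deriv Suc.prems)
qed

lemma Ck_on_sum:
  assumes "open S" "\<And>i. i \<in> I \<Longrightarrow> Ck_on k S (f i)"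
  shows "Ck_on k S (\<lambda>x. \<Sum>i\<in>I. f i x)"
  using assms(2)
  by (induction I rule: infinite_finite_induct) (auto intro!: Ck_on_const Ck_on_add[OF \<open>open S\<close>])

lemma Ck_on_bilinear:
  assumes "bounded_bilinear h" "open S" "Ck_on k S f" "Ck_on k S g"
  shows "Ck_on k S (\<lambda>x. h (f x) (g x))"
  using assms(3,4)
proof (induction k arbitrary: f g)
  case 0
  then show ?case by (simp add: bounded_bilinear.continuous_on[OF assms(1)])
next
  case (Suc k)
  show ?case
  proof (rule Ck_on_SucI[OF \<open>open S\<close>])
    show "((\<lambda>x. h (f x) (g x)) has_derivative (\<lambda>v. h (f x) (frechet_derivative g (at x) v)
        + h (frechet_derivative f (at x) v) (g x))) (at x)" if "x \<in> S" for x
      using Suc.prems that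
      by (intro bounded_bilinear.FDERIV[OF assms(1)] Ck_on_has_derivative)
    show "Ck_on k S (\<lambda>x. h (f x) (frechet_derivative g (at x) v)
        + h (frechet_derivative f (at x) v) (g x))" for v
      using Suc.prems by (intro Ck_on_add[OF \<open>open S\<close>] Suc.IH) (auto intro: Ck_on_SucD Ck_on_deriv)
  qed
qed

lemmas Ck_on_mult = Ck_on_bilinear[OF bounded_bilinear_mult]
  and Ck_on_scaleR = Ck_on_bilinear[OF bounded_bilinear_scaleR]
  and Ck_on_inner = Ck_on_bilinear[OF bounded_bilinear_inner]

lemma Ck_on_Pair:
  assumes "open S" "Ck_on k S f" "Ck_on k S g"
  shows "Ck_on k S (\<lambda>x. (f x, g x))"
  using assms(2,3)
proof (induction k arbitrary: f g)
  case 0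
  then show ?case by (simp add: continuous_on_Pair)
next
  case (Suc k)
  show ?case
  proof (rule Ck_on_SucI[OF \<open>open S\<close>])
    show "((\<lambda>x. (f x, g x)) has_derivative
        (\<lambda>v. (frechet_derivative f (at x) v, frechet_derivative g (at x) v))) (at x)" if "x \<in> S" for x
      using Suc.prems that by (intro has_derivative_Pair Ck_on_has_derivative)
  qed (intro Suc.IH Ck_on_deriv Suc.prems)
qed

lemma linear_sum_Basis:
  assumes "linear f"
  shows "f w = (\<Sum>b\<in>Basis. (w \<bullet> b) *\<^sub>R f b)"
  using linear_sum[OF assms, of "\<lambda>b. (w \<bullet> b) *\<^sub>R b" Basis]
  unfolding euclidean_representation by (simp add: linear_cmul[OF assms])

text \<open>
  The chain rule is expanded in an orthonormal basis: a directional derivative of the composition is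
  then a finite sum of products of directional derivatives of \<open>f\<close> with compositions
  \<open>\<partial>\<^sub>b g \<circ> f\<close>, to which the induction hypothesis applies.
\<close>

lemma Ck_on_compose:
  assumes "open S" "open T" "Ck_on k S f" "Ck_on k T g" "\<And>x. x \<in> S \<Longrightarrow> f x \<in> T"
  shows "Ck_on k S (\<lambda>x. g (f x))"
  using assms(3,4)
proof (induction k arbitrary: g)
  case 0
  then show ?case
    using continuous_on_compose2[of T g S f] assms(5) by auto
next
  case (Suc k)
  note Df = Ck_on_has_derivative[OF \<open>Ck_on (Suc k) S f\<close>]
    and Dg = Ck_on_has_derivative[OF \<open>Ck_on (Suc k) T g\<close>]
  let ?D = "\<lambda>x v. \<Sum>b\<in>Basis. (frechet_derivative f (at x) v \<bullet> b) *\<^sub>R frechet_derivative g (at (f x)) b"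
  show ?case
  proof (rule Ck_on_SucI[OF \<open>open S\<close>])
    fix x assume "x \<in> S"
    have "linear (frechet_derivative g (at (f x)))"
      using Dg[OF assms(5)[OF \<open>x \<in> S\<close>]] has_derivative_linear by blast
    moreover have "((\<lambda>x. g (f x)) has_derivative
        (\<lambda>v. frechet_derivative g (at (f x)) (frechet_derivative f (at x) v))) (at x)"
      by (rule has_derivative_compose[OF Df Dg]) (use \<open>x \<in> S\<close> assms(5) in auto)
    ultimately show "((\<lambda>x. g (f x)) has_derivative ?D x) (at x)"
      by (simp add: linear_sum_Basis[of "frechet_derivative g (at (f x))"])
  next
    fix v
    show "Ck_on k S (\<lambda>x. ?D x v)"
      using Suc.prems
      by (intro Ck_on_sum Ck_on_scaleR Ck_on_inner Ck_on_const Suc.IH \<open>open S\<close>) (auto intro: Ck_on_SucD Ck_on_deriv)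
  qed
qed

lemma Ck_on_inverse:
  fixes f :: "'a::euclidean_space \<Rightarrow> real"
  assumes "open S" "Ck_on k S f" "\<And>x. x \<in> S \<Longrightarrow> f x \<noteq> 0"
  shows "Ck_on k S (\<lambda>x. inverse (f x))"
  using assms(2)
proof (induction k)
  case 0
  then show ?case using assms by (simp add: continuous_on_inverse)
next
  case (Suc k)
  show ?case
  proof (rule Ck_on_SucI[OF \<open>open S\<close>])
    show "((\<lambda>x. inverse (f x)) has_derivative
        (\<lambda>v. - 1 * (inverse (f x) * frechet_derivative f (at x) v * inverse (f x)))) (at x)" if "x \<in> S" for x
      using Deriv.has_derivative_inverse[OF assms(3)[OF that] Ck_on_has_derivative[OF Suc.prems that]] by simp
    show "Ck_on k S (\<lambda>x. - 1 * (inverse (f x) * frechet_derivative f (at x) v * inverse (f x)))" for v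
      using Suc by (intro Ck_on_mult Ck_on_const \<open>open S\<close>) (auto intro: Ck_on_SucD Ck_on_deriv)
  qed
qed

lemma Ck_on_divide:
  fixes f g :: "'a::euclidean_space \<Rightarrow> real"
  assumes "open S" "Ck_on k S f" "Ck_on k S g" "\<And>x. x \<in> S \<Longrightarrow> g x \<noteq> 0"
  shows "Ck_on k S (\<lambda>x. f x / g x)"
  unfolding divide_inverse by (intro Ck_on_mult Ck_on_inverse assms)

section \<open>Centroaffine hypersurfaces as radial graphs\<close>

text \<open>
  The source of all tangent vectors below: a parametrised line segment that a smooth map sends into
  \<open>H\<close>. It is used for slice charts and for the radial projection onto \<open>H\<close>.
\<close>

lemma tangent_space_line:
  fixes H :: "'a::euclidean_space set" and \<theta> :: "'b::euclidean_space \<Rightarrow> 'a"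
  assumes "open W" "b \<in> W" "\<And>k. Ck_on k W \<theta>" "(\<theta> has_derivative D) (at b)"
    and H: "\<And>t. b + t *\<^sub>R w \<in> W \<Longrightarrow> \<theta> (b + t *\<^sub>R w) \<in> H"
  shows "D w \<in> tangent_space H (\<theta> b)"
proof -
  define \<gamma> where "\<gamma> t = \<theta> (b + t *\<^sub>R w)" for t :: real
  have "open ((\<lambda>t. b + t *\<^sub>R w) -` W)"
    by (intro open_vimage \<open>open W\<close> continuous_intros)
  moreover have "0 \<in> (\<lambda>t. b + t *\<^sub>R w) -` W"
    using \<open>b \<in> W\<close> by simp
  ultimately obtain \<epsilon> where "\<epsilon> > 0" "ball 0 \<epsilon> \<subseteq> (\<lambda>t. b + t *\<^sub>R w) -` W"
    by (meson openE)
  then have \<epsilon>: "b + t *\<^sub>R w \<in> W" if "t \<in> {-\<epsilon><..<\<epsilon>}" for t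
    using that by (auto simp: subset_iff dist_real_def abs_if split: if_splits)
  have lin: "Ck_on k {-\<epsilon><..<\<epsilon>} (\<lambda>t. b + t *\<^sub>R w)" for k
    by (intro Ck_on_add Ck_on_const Ck_on_linear bounded_linear_scaleR_left) simp
  have "smooth_on {-\<epsilon><..<\<epsilon>} \<gamma>"
    unfolding smooth_on_open[OF open_greaterThanLessThan] \<gamma>_def
    using Ck_on_compose[OF open_greaterThanLessThan \<open>open W\<close> lin assms(3) \<epsilon>] by blast
  moreover have "\<gamma> ` {-\<epsilon><..<\<epsilon>} \<subseteq> H"
    unfolding \<gamma>_def using \<epsilon> H by blast
  moreover have "(\<gamma> has_vector_derivative D w) (at 0)"
  proof -
    have "((\<lambda>t. b + t *\<^sub>R w) has_derivative (\<lambda>t. t *\<^sub>R w)) (at 0)"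
      by (auto intro!: derivative_eq_intros)
    moreover have "(\<theta> has_derivative D) (at (b + 0 *\<^sub>R w))"
      using assms(4) by simp
    ultimately have "(\<gamma> has_derivative (\<lambda>t. D (t *\<^sub>R w))) (at 0)"
      unfolding \<gamma>_def by (rule has_derivative_compose)
    then show ?thesis
      by (simp add: has_vector_derivative_def linear_cmul[OF has_derivative_linear[OF assms(4)]])
  qed
  moreover have "\<gamma> 0 = \<theta> b" by (simp add: \<gamma>_def)
  ultimately show ?thesis
    unfolding tangent_space_def using \<open>\<epsilon> > 0\<close> by (intro CollectI exI[of _ \<gamma>] exI[of _ \<epsilon>]) simp
qed

lemma hyperbolic_imp_centroaffine:
  "hyperbolic_centroaffine_hypersurface H \<Longrightarrow> centroaffine_hypersurface H"
  by (simp add: hyperbolic_centroaffine_hypersurface_def)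

text \<open>
  The constant curve makes 0 a tangent vector at every point of \<open>H\<close>.
\<close>

lemma centroaffine_nonzero:
  assumes "centroaffine_hypersurface H" "x \<in> H"
  shows "x \<noteq> 0"
proof
  assume "x = 0"
  moreover have "0 \<in> tangent_space H x"
    unfolding tangent_space_def using assms(2)
    by (intro CollectI exI[of _ "\<lambda>_. x"] exI[of _ 1]) (auto simp: smooth_on_open Ck_on_const)
  ultimately show False using assms by (auto simp: centroaffine_hypersurface_def)
qed

text \<open>
  With a slice chart \<open>\<psi>\<close> onto the hyperplane orthogonal to \<open>a\<close>, the function \<open>G = a \<bullet> \<psi>\<close> vanishes exactly
  on \<open>H\<close>. A vector \<open>v\<close> in the kernel of its derivative is mapped by the derivative of \<open>\<psi>\<close> into the
  hyperplane; pulling back a line in that direction shows that \<open>v\<close> is tangent. Thus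
  \<open>dG\<^sub>p p \<noteq> 0\<close> on a centroaffine hypersurface.
\<close>

lemma hypersurface_defining_function:
  assumes "embedded_hypersurface H" "p \<in> H"
  obtains V and G :: "'a::euclidean_space \<Rightarrow> real" where "open V" "p \<in> V" "\<And>k. Ck_on k V G"
    "\<And>q. q \<in> V \<Longrightarrow> q \<in> H \<longleftrightarrow> G q = 0"
    "\<And>v. frechet_derivative G (at p) v = 0 \<Longrightarrow> v \<in> tangent_space H p"
proof -
  from assms obtain V W :: "'a set" and \<psi> :: "'a \<Rightarrow> 'a" and a
    where "open V" "p \<in> V" "open W" and diff: "diffeomorphism_on V W \<psi>"
      and slice: "\<psi> ` (V \<inter> H) = W \<inter> {y. a \<bullet> y = 0}"
    unfolding embedded_hypersurface_def by meson
  define \<theta> where "\<theta> = inv_into V \<psi>"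
  define D where "D = frechet_derivative \<psi> (at p)"
  have bij: "bij_betw \<psi> V W" and C\<psi>: "\<And>k. Ck_on k V \<psi>" and C\<theta>: "\<And>k. Ck_on k W \<theta>"
    using diff \<open>open V\<close> \<open>open W\<close> unfolding diffeomorphism_on_def \<theta>_def by (auto simp: smooth_on_open)
  have inj: "inj_on \<psi> V" and \<psi>W: "\<And>q. q \<in> V \<Longrightarrow> \<psi> q \<in> W"
    using bij by (auto simp: bij_betw_def)
  have \<theta>\<psi>: "\<theta> (\<psi> q) = q" if "q \<in> V" for q
    unfolding \<theta>_def using inj that by (rule inv_into_f_f)
  define G where "G q = a \<bullet> \<psi> q" for q
  have CG: "Ck_on k V G" for k
    unfolding G_def by (intro Ck_on_inner Ck_on_const C\<psi> \<open>open V\<close>)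
  have zero: "q \<in> H \<longleftrightarrow> G q = 0" if q: "q \<in> V" for q
  proof
    assume "q \<in> H"
    then have "\<psi> q \<in> \<psi> ` (V \<inter> H)" using q by blast
    then show "G q = 0" unfolding slice G_def by simp
  next
    assume "G q = 0"
    then have "\<psi> q \<in> \<psi> ` (V \<inter> H)" unfolding slice G_def using \<psi>W[OF q] by simp
    then show "q \<in> H" using inj q by (auto dest: inj_onD)
  qed
  have D: "(\<psi> has_derivative D) (at p)"
    unfolding D_def using C\<psi> \<open>p \<in> V\<close> by (rule Ck_on_has_derivative)
  have D\<theta>: "(\<theta> has_derivative frechet_derivative \<theta> (at (\<psi> p))) (at (\<psi> p))"
    using C\<theta> \<psi>W[OF \<open>p \<in> V\<close>] by (rule Ck_on_has_derivative)
  have "((\<lambda>q. \<theta> (\<psi> q)) has_derivative (\<lambda>v. frechet_derivative \<theta> (at (\<psi> p)) (D v))) (at p)"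
    by (rule has_derivative_compose[OF D D\<theta>])
  then have "((\<lambda>q. q) has_derivative (\<lambda>v. frechet_derivative \<theta> (at (\<psi> p)) (D v))) (at p)"
    by (rule has_derivative_transform_within_open[OF _ \<open>open V\<close> \<open>p \<in> V\<close> \<theta>\<psi>])
  then have "(\<lambda>v. frechet_derivative \<theta> (at (\<psi> p)) (D v)) = (\<lambda>v. v)"
    using has_derivative_ident by (rule has_derivative_unique)
  then have inv: "frechet_derivative \<theta> (at (\<psi> p)) (D v) = v" for v
    by (rule fun_cong)
  have "v \<in> tangent_space H p" if v: "frechet_derivative G (at p) v = 0" for v
  proof -
    have "(G has_derivative (\<lambda>v. a \<bullet> D v)) (at p)"
      unfolding G_def by (rule has_derivative_inner_right[OF D])
    then have "frechet_derivative G (at p) = (\<lambda>v. a \<bullet> D v)"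
      by (rule frechet_derivative_at[symmetric])
    then have aD: "a \<bullet> D v = 0" using v by simp
    have "G p = 0" using zero[OF \<open>p \<in> V\<close>] \<open>p \<in> H\<close> by simp
    then have "\<theta> (\<psi> p + t *\<^sub>R D v) \<in> H" if "\<psi> p + t *\<^sub>R D v \<in> W" for t
    proof -
      have "\<psi> p + t *\<^sub>R D v \<in> W \<inter> {y. a \<bullet> y = 0}"
        using that \<open>G p = 0\<close> aD by (simp add: G_def inner_add_right)
      then show ?thesis unfolding slice[symmetric] using \<theta>\<psi> by auto
    qed
    then have "frechet_derivative \<theta> (at (\<psi> p)) (D v) \<in> tangent_space H (\<theta> (\<psi> p))"
      by (intro tangent_space_line[OF \<open>open W\<close> \<psi>W[OF \<open>p \<in> V\<close>] C\<theta> D\<theta>])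
    then show ?thesis using inv \<theta>\<psi>[OF \<open>p \<in> V\<close>] by simp
  qed
  then show ?thesis using that[OF \<open>open V\<close> \<open>p \<in> V\<close> CG zero] by blast
qed

text \<open>
  The inverse function theorem with the derivative given pointwise instead of as a continuous map
  into the space of bounded linear operators.
\<close>

lemma C1_local_inverse:
  fixes f :: "'a::euclidean_space \<Rightarrow> 'a"
  assumes "open U" "Ck_on (Suc 0) U f" "x0 \<in> U" "inj (frechet_derivative f (at x0))"
  obtains U' V g where "open U'" "U' \<subseteq> U" "x0 \<in> U'" "open V" "homeomorphism U' V f g"
    "\<And>y. y \<in> V \<Longrightarrow> g differentiable (at y)"
proof -
  define f' where "f' x = Blinfun (frechet_derivative f (at x))" for x
  have der: "(f has_derivative frechet_derivative f (at x)) (at x)" if "x \<in> U" for x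
    by (rule Ck_on_has_derivative[OF assms(2) that])
  have f': "blinfun_apply (f' x) = frechet_derivative f (at x)" if "x \<in> U" for x
    unfolding f'_def by (rule bounded_linear_Blinfun_apply[OF has_derivative_bounded_linear[OF der[OF that]]])
  have contf': "continuous_on U f'"
  proof (rule continuous_on_blinfun_componentwise)
    fix i :: 'a
    have "continuous_on U (\<lambda>x. frechet_derivative f (at x) i)"
      using Ck_on_deriv[OF assms(2)] by simp
    then show "continuous_on U (\<lambda>x. blinfun_apply (f' x) i)"
      by (rule continuous_on_eq) (simp add: f')
  qed
  have "linear (frechet_derivative f (at x0))"
    using der[OF \<open>x0 \<in> U\<close>] by (rule has_derivative_linear)
  then obtain h where h: "linear h" "h \<circ> frechet_derivative f (at x0) = id"
    using linear_injective_left_inverse[OF _ assms(4)] by blast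
  have invf: "Blinfun h o\<^sub>L f' x0 = id_blinfun"
  proof (rule blinfun_eqI)
    fix i
    show "(Blinfun h o\<^sub>L f' x0) i = id_blinfun i"
      using h by (simp add: f'[OF \<open>x0 \<in> U\<close>] bounded_linear_Blinfun_apply linear_linear fun_eq_iff)
  qed
  have der': "(f has_derivative blinfun_apply (f' x)) (at x)" if "x \<in> U" for x
    using der[OF that] f'[OF that] by simp
  show ?thesis
  proof (rule inverse_function_theorem[OF assms(1) der' contf' assms(3) invf])
    fix U' V g g'
    assume "open U'" "U' \<subseteq> U" "x0 \<in> U'" "open V" "homeomorphism U' V f g"
      and "\<And>y. y \<in> V \<Longrightarrow> (g has_derivative g' y) (at y)"
    then show thesis by (intro that[of U' V g] differentiableI)
  qed
qed

lemma has_derivative_radial_projection: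
  fixes F :: "'a::euclidean_space \<Rightarrow> real"
  assumes "(F has_derivative F') (at q)" "F q \<noteq> 0"
  shows "((\<lambda>q. q /\<^sub>R F q) has_derivative (\<lambda>v. v /\<^sub>R F q - (F' v / (F q)\<^sup>2) *\<^sub>R q)) (at q)"
  using has_derivative_scaleR[OF Deriv.has_derivative_inverse[OF assms(2,1)] has_derivative_ident]
  by (rule has_derivative_eq_rhs) (simp add: fun_eq_iff power2_eq_square divide_inverse mult_ac)

text \<open>
  The implicit function theorem for the equation \<open>G (q / s) = 0\<close> in the unknown \<open>s\<close>, near the solution
  \<open>s = 1\<close> at \<open>q = p\<close>. The derivative in \<open>s\<close> at this solution is \<open>- dG\<^sub>p p\<close>, so the solution \<open>s = F q\<close>
  exists and is differentiable. Differentiating the equation gives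
  \<open>dF\<^sub>q v = F q * dG v / dG q\<close> with \<open>dG\<close> taken at \<open>q / F q\<close>. The right-hand side is as often
  differentiable as \<open>F\<close> itself, hence \<open>F\<close> is smooth by bootstrapping.
\<close>

lemma implicit_radial_function:
  fixes G :: "'a::euclidean_space \<Rightarrow> real"
  assumes "open V" "p \<in> V" "\<And>k. Ck_on k V G" "G p = 0" "frechet_derivative G (at p) p \<noteq> 0"
  obtains N J F where "open N" "p \<in> N" "open J" "1 \<in> J" "J \<subseteq> {0<..}" "F ` N \<subseteq> J"
    "\<And>k. Ck_on k N F" "\<And>q s. q \<in> N \<Longrightarrow> s \<in> J \<Longrightarrow> q /\<^sub>R s \<in> V"
    "\<And>q s. q \<in> N \<Longrightarrow> s \<in> J \<Longrightarrow> G (q /\<^sub>R s) = 0 \<longleftrightarrow> s = F q"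
proof -
  define m where "m z = fst z /\<^sub>R snd z" for z :: "'a \<times> real"
  define \<Theta> where "\<Theta> z = (fst z, G (m z))" for z
  define P where "P = (UNIV :: 'a set) \<times> {0::real<..}"
  define U where "U = P \<inter> m -` V"
  have "open P" unfolding P_def by (intro open_Times) auto
  have Cm: "Ck_on k P m" for k
    unfolding m_def
    by (intro Ck_on_scaleR Ck_on_inverse Ck_on_linear bounded_linear_fst bounded_linear_snd \<open>open P\<close>)
       (auto simp: P_def)
  have "open U"
    unfolding U_def
    by (rule continuous_open_preimage[OF Ck_on_continuous[OF Cm] \<open>open P\<close> \<open>open V\<close>])
  have CU: "Ck_on k U \<Theta>" for k
    unfolding \<Theta>_def
    by (intro Ck_on_Pair Ck_on_linear bounded_linear_fst \<open>open U\<close>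
          Ck_on_compose[OF \<open>open U\<close> \<open>open V\<close> Ck_on_subset[OF Cm] assms(3)]) (auto simp: U_def)
  have p1: "(p, 1) \<in> U" using \<open>p \<in> V\<close> by (simp add: U_def P_def m_def)
  have DG: "(G has_derivative frechet_derivative G (at x)) (at x)" if "x \<in> V" for x
    using assms(3) that by (rule Ck_on_has_derivative)
  have linG: "linear (frechet_derivative G (at x))" if "x \<in> V" for x
    using DG[OF that] by (rule has_derivative_linear)
  have "(m has_derivative (\<lambda>z. fst z - snd z *\<^sub>R p)) (at (p, 1))"
    unfolding m_def by (auto intro!: derivative_eq_intros)
  moreover have "(G has_derivative frechet_derivative G (at p)) (at (m (p, 1)))"
    using DG[OF \<open>p \<in> V\<close>] by (simp add: m_def)
  ultimately have "((\<lambda>z. G (m z)) has_derivative (\<lambda>z. frechet_derivative G (at p) (fst z - snd z *\<^sub>R p))) (at (p, 1))"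
    by (rule has_derivative_compose)
  then have "(\<Theta> has_derivative (\<lambda>z. (fst z, frechet_derivative G (at p) (fst z - snd z *\<^sub>R p)))) (at (p, 1))"
    unfolding \<Theta>_def by (intro has_derivative_Pair has_derivative_fst has_derivative_ident)
  then have D\<Theta>: "frechet_derivative \<Theta> (at (p, 1)) = (\<lambda>z. (fst z, frechet_derivative G (at p) (fst z - snd z *\<^sub>R p)))"
    by (rule frechet_derivative_at[symmetric])
  have "inj (frechet_derivative \<Theta> (at (p, 1)))"
    unfolding D\<Theta> using assms(5)
    by (auto simp: inj_def linear_diff[OF linG[OF \<open>p \<in> V\<close>]] linear_cmul[OF linG[OF \<open>p \<in> V\<close>]])
  then obtain U' V' g where "open U'" "U' \<subseteq> U" "(p, 1) \<in> U'" "open V'"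
    and hom: "homeomorphism U' V' \<Theta> g" and gdiff: "\<And>y. y \<in> V' \<Longrightarrow> g differentiable (at y)"
    by (rule C1_local_inverse[OF \<open>open U\<close> CU p1]) (rule that)
  have g\<Theta>: "g (\<Theta> z) = z" if "z \<in> U'" for z using hom that by (simp add: homeomorphism_apply1)
  have \<Theta>g: "\<Theta> (g y) = y" if "y \<in> V'" for y using hom that by (simp add: homeomorphism_apply2)
  \<comment> \<open>A product neighbourhood separates the choice of \<open>q\<close> from that of the scaling factor.\<close>
  obtain A J where "open A" "open J" "(p, 1) \<in> A \<times> J" "A \<times> J \<subseteq> U'"
    using open_prod_elim[OF \<open>open U'\<close> \<open>(p, 1) \<in> U'\<close>] by blast
  define F where "F q = snd (g (q, 0))" for q
  have gF: "g (q, 0) = (q, F q)" if "(q, 0) \<in> V'" for q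
    using arg_cong[OF \<Theta>g[OF that], of fst] by (simp add: F_def \<Theta>_def prod_eq_iff)
  have inV: "q /\<^sub>R s \<in> V \<and> 0 < s" if "(q, s) \<in> U'" for q s
    using that \<open>U' \<subseteq> U\<close> by (auto simp: U_def P_def m_def)
  define N0 where "N0 = A \<inter> {q. (q, 0) \<in> V'}"
  have "open N0"
  proof -
    have "open ((\<lambda>q. (q, 0::real)) -` V')"
      by (intro open_vimage \<open>open V'\<close> continuous_intros)
    then show ?thesis unfolding N0_def using \<open>open A\<close> by (auto simp: vimage_def)
  qed
  have Fdiff: "F differentiable (at q)" if "q \<in> N0" for q
  proof -
    have "(q, 0) \<in> V'" using that by (simp add: N0_def)
    then obtain g' where "(g has_derivative g') (at (q, 0))"
      using gdiff unfolding differentiable_def by blast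
    moreover have "((\<lambda>q. (q, 0::real)) has_derivative (\<lambda>v. (v, 0))) (at q)"
      by (intro has_derivative_Pair has_derivative_ident has_derivative_const)
    ultimately have "((\<lambda>q. g (q, 0)) has_derivative (\<lambda>v. g' (v, 0))) (at q)"
      by (rule has_derivative_compose[rotated])
    then show ?thesis unfolding F_def
      by (rule differentiableI[OF has_derivative_snd])
  qed
  then have contF: "continuous_on N0 F"
    by (simp add: continuous_at_imp_continuous_on differentiable_imp_continuous_within)
  define N1 where "N1 = N0 \<inter> F -` J"
  have "open N1"
    unfolding N1_def by (rule continuous_open_preimage[OF contF \<open>open N0\<close> \<open>open J\<close>])
  have F: "q /\<^sub>R s \<in> V \<and> s > 0 \<and> (G (q /\<^sub>R s) = 0 \<longleftrightarrow> s = F q)" if qs: "q \<in> N1" "s \<in> J" for q s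
  proof -
    have "(q, s) \<in> U'" and q0: "(q, 0) \<in> V'"
      using qs \<open>A \<times> J \<subseteq> U'\<close> by (auto simp: N1_def N0_def)
    have "s = F q" if "G (q /\<^sub>R s) = 0"
    proof -
      have "\<Theta> (q, s) = (q, 0)" using that by (simp add: \<Theta>_def m_def)
      then show ?thesis using g\<Theta>[OF \<open>(q, s) \<in> U'\<close>] gF[OF q0] by simp
    qed
    moreover have "G (q /\<^sub>R F q) = 0"
      using \<Theta>g[OF q0] by (simp add: gF[OF q0] \<Theta>_def m_def)
    ultimately show ?thesis using inV[OF \<open>(q, s) \<in> U'\<close>] by blast
  qed
  \<comment> \<open>The denominator \<open>dG q\<close> of the formula for \<open>dF\<close>, written as a sum so that its differentiability
    follows from that of \<open>F\<close>; it may vanish away from \<open>p\<close>, so the domain shrinks once more.\<close>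
  define h where "h q = (\<Sum>b\<in>Basis. (q \<bullet> b) * frechet_derivative G (at (q /\<^sub>R F q)) b)" for q
  have inJ: "F q \<in> J" if "q \<in> N1" for q using that by (simp add: N1_def)
  have GF: "G (q /\<^sub>R F q) = 0" if "q \<in> N1" for q
    using F[OF that inJ[OF that]] by blast
  have h: "h q = frechet_derivative G (at (q /\<^sub>R F q)) q" if "q \<in> N1" for q
    unfolding h_def using linear_sum_Basis[OF linG, of "q /\<^sub>R F q" q] F[OF that inJ[OF that]] by simp
  have Cdiv: "Ck_on k N (\<lambda>q. q /\<^sub>R F q)" if "open N" "N \<subseteq> N1" "Ck_on k N F" for k N
  proof (rule Ck_on_scaleR[OF that(1) Ck_on_inverse[OF that(1,3)] Ck_on_linear[OF bounded_linear_ident]])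
    fix q assume "q \<in> N"
    then have "q \<in> N1" using that(2) by blast
    then show "F q \<noteq> 0" using F[OF _ inJ] by force
  qed
  have CdG: "Ck_on k N (\<lambda>q. frechet_derivative G (at (q /\<^sub>R F q)) v)" if "open N" "N \<subseteq> N1" "Ck_on k N F" for k N v
    by (rule Ck_on_compose[OF \<open>open N\<close> \<open>open V\<close> Cdiv[OF that] Ck_on_deriv[OF assms(3)]])
       (use F inJ that in blast)
  have Ch: "Ck_on k N h" if "open N" "N \<subseteq> N1" "Ck_on k N F" for k N
    unfolding h_def
    by (intro Ck_on_sum Ck_on_mult Ck_on_inner Ck_on_linear bounded_linear_ident Ck_on_const CdG that)
  define N where "N = N1 \<inter> h -` (- {0})"
  have "continuous_on N1 h"
    using Ch[OF \<open>open N1\<close> order_refl, of 0] contF by (simp add: N1_def continuous_on_subset)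
  then have "open N"
    unfolding N_def by (intro continuous_open_preimage \<open>open N1\<close>) auto
  have "N \<subseteq> N1" by (auto simp: N_def)
  have DF: "(F has_derivative (\<lambda>v. F q * frechet_derivative G (at (q /\<^sub>R F q)) v / h q)) (at q)"
    if q: "q \<in> N" for q
  proof -
    have q1: "q \<in> N1" "h q \<noteq> 0" using q by (auto simp: N_def)
    have Fq: "F q > 0" "q /\<^sub>R F q \<in> V" using F[OF q1(1) inJ[OF q1(1)]] by auto
    let ?F = "frechet_derivative F (at q)" and ?G = "frechet_derivative G (at (q /\<^sub>R F q))"
    have F': "(F has_derivative ?F) (at q)"
      using Fdiff q1 unfolding frechet_derivative_works[symmetric] by (auto simp: N1_def)
    have "((\<lambda>q. q /\<^sub>R F q) has_derivative (\<lambda>v. v /\<^sub>R F q - (?F v / (F q)\<^sup>2) *\<^sub>R q)) (at q)"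
      using F' Fq by (intro has_derivative_radial_projection) simp_all
    then have "((\<lambda>q. G (q /\<^sub>R F q)) has_derivative (\<lambda>v. ?G (v /\<^sub>R F q - (?F v / (F q)\<^sup>2) *\<^sub>R q))) (at q)"
      using DG[OF Fq(2)] by (rule has_derivative_compose)
    moreover have "((\<lambda>q. G (q /\<^sub>R F q)) has_derivative (\<lambda>v. 0)) (at q)"
      by (rule has_derivative_transform_within_open[OF has_derivative_const \<open>open N1\<close> q1(1)])
         (simp add: GF)
    ultimately have "(\<lambda>v. ?G (v /\<^sub>R F q - (?F v / (F q)\<^sup>2) *\<^sub>R q)) = (\<lambda>v. 0)"
      by (rule has_derivative_unique)
    then have "?G v / F q = ?F v / (F q)\<^sup>2 * ?G q" for v
      by (simp add: linear_diff[OF linG[OF Fq(2)]] linear_cmul[OF linG[OF Fq(2)]] fun_eq_iff divide_inverse mult_ac)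
    then have "?F v = F q * ?G v / h q" for v
      using Fq(1) q1(2) h[OF q1(1)] by (simp add: field_simps power2_eq_square)
    then have "?F = (\<lambda>v. F q * ?G v / h q)" by (rule ext)
    then show ?thesis using F' by simp
  qed
  have CF: "Ck_on k N F" for k
  proof (induction k)
    case 0
    then show ?case using contF \<open>N \<subseteq> N1\<close> by (auto simp: N1_def intro: continuous_on_subset)
  next
    case (Suc k)
    show ?case
    proof (rule Ck_on_SucI[OF \<open>open N\<close> DF])
      show "Ck_on k N (\<lambda>x. F x * frechet_derivative G (at (x /\<^sub>R F x)) v / h x)" for v
        by (intro Ck_on_divide Ck_on_mult Suc CdG Ch \<open>open N\<close> \<open>N \<subseteq> N1\<close>) (simp add: N_def)
    qed
  qed
  have "\<Theta> (p, 1) = (p, 0)" using assms(4) by (simp add: \<Theta>_def m_def)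
  moreover have "\<Theta> (p, 1) \<in> V'" using hom \<open>(p, 1) \<in> U'\<close> by (auto simp: homeomorphism_def)
  ultimately have p0: "(p, 0) \<in> V'" and Fp: "F p = 1"
    using g\<Theta>[OF \<open>(p, 1) \<in> U'\<close>] by (auto simp: F_def)
  have pN1: "p \<in> N1" using p0 Fp \<open>(p, 1) \<in> A \<times> J\<close> by (simp add: N1_def N0_def)
  have "p \<in> N" using pN1 h[OF pN1] Fp assms(5) by (simp add: N_def)
  moreover have "J \<subseteq> {0<..}" using F[OF pN1] by auto
  moreover have "F ` N \<subseteq> J" using inJ \<open>N \<subseteq> N1\<close> by blast
  moreover have "q /\<^sub>R s \<in> V" "G (q /\<^sub>R s) = 0 \<longleftrightarrow> s = F q" if "q \<in> N" "s \<in> J" for q s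
    using F[of q s] that \<open>N \<subseteq> N1\<close> by blast+
  ultimately show ?thesis
    using that[of N J F, OF \<open>open N\<close> _ \<open>open J\<close> _ _ _ CF] \<open>(p, 1) \<in> A \<times> J\<close> by blast
qed

text \<open>
  Over \<open>N\<close>, the part of \<open>H\<close> that is reached with scaling factors in \<open>J\<close> is the graph of \<open>F\<close> in polar
  form. The set \<open>J\<close> confines the statement to one sheet: other multiples of \<open>q\<close> may lie in \<open>H\<close> as well,
  as injectivity of the cone map is still unknown.
\<close>

definition radial_graph ::
  "'a::euclidean_space set \<Rightarrow> 'a set \<Rightarrow> real set \<Rightarrow> ('a \<Rightarrow> real) \<Rightarrow> bool" where
  "radial_graph H N J F \<longleftrightarrow>
     open N \<and> open J \<and> J \<subseteq> {0<..} \<and> F ` N \<subseteq> J \<and> (\<forall>k. Ck_on k N F) \<and>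
     (\<forall>q\<in>N. \<forall>s\<in>J. q /\<^sub>R s \<in> H \<longleftrightarrow> s = F q)"

lemma radial_graphD:
  assumes "radial_graph H N J F"
  shows "open N" "open J" "Ck_on k N F" "q \<in> N \<Longrightarrow> F q \<in> J" "s \<in> J \<Longrightarrow> 0 < s"
    "q \<in> N \<Longrightarrow> s \<in> J \<Longrightarrow> q /\<^sub>R s \<in> H \<longleftrightarrow> s = F q"
  using assms unfolding radial_graph_def by auto

lemma radial_graph_exists:
  assumes "centroaffine_hypersurface H" "p \<in> H"
  obtains N J F where "radial_graph H N J F" "p \<in> N" "1 \<in> J"
proof -
  have H: "embedded_hypersurface H" and trans: "p \<notin> tangent_space H p"
    using assms by (auto simp: centroaffine_hypersurface_def)
  obtain V and G :: "'a \<Rightarrow> real" where V: "open V" "p \<in> V" and CG: "\<And>k. Ck_on k V G"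
    and zero: "\<And>q. q \<in> V \<Longrightarrow> q \<in> H \<longleftrightarrow> G q = 0"
    and tan: "\<And>v. frechet_derivative G (at p) v = 0 \<Longrightarrow> v \<in> tangent_space H p"
    by (rule hypersurface_defining_function[OF H \<open>p \<in> H\<close>]) (rule that)
  have "G p = 0" using zero V assms(2) by blast
  moreover have "frechet_derivative G (at p) p \<noteq> 0" using tan trans by blast
  ultimately obtain N J F where "open N" "p \<in> N" "open J" "1 \<in> J" "J \<subseteq> {0<..}" "F ` N \<subseteq> J"
    and CF: "\<And>k. Ck_on k N F" and inV: "\<And>q s. q \<in> N \<Longrightarrow> s \<in> J \<Longrightarrow> q /\<^sub>R s \<in> V"
    and F: "\<And>q s. q \<in> N \<Longrightarrow> s \<in> J \<Longrightarrow> G (q /\<^sub>R s) = 0 \<longleftrightarrow> s = F q"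
    by (rule implicit_radial_function[OF V CG]) (rule that)
  then have "radial_graph H N J F"
    unfolding radial_graph_def using zero by (intro conjI allI ballI) simp_all
  then show ?thesis using that \<open>p \<in> N\<close> \<open>1 \<in> J\<close> by blast
qed

lemma radial_graph_scale:
  assumes "radial_graph H N J F" "0 < r"
  shows "radial_graph H ((*\<^sub>R) r ` N) ((*) r ` J) (\<lambda>q. r * F (q /\<^sub>R r))"
proof -
  note F = radial_graphD[OF assms(1)]
  have opN: "open ((*\<^sub>R) r ` N)"
    using F(1) assms(2) by (intro open_scaling) auto
  have opJ: "open ((*) r ` J)"
    using open_scaling[of r J] F(2) assms(2) by simp
  have C: "Ck_on k ((*\<^sub>R) r ` N) (\<lambda>q. r * F (q /\<^sub>R r))" for k
  proof (rule Ck_on_mult[OF opN Ck_on_const])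
    show "Ck_on k ((*\<^sub>R) r ` N) (\<lambda>q. F (q /\<^sub>R r))"
      by (rule Ck_on_compose[OF opN F(1) Ck_on_linear F(3)])
         (use assms(2) in \<open>auto intro: bounded_linear_scaleR_right\<close>)
  qed
  have eq: "(r *\<^sub>R q) /\<^sub>R (r * s) = q /\<^sub>R s" for q :: 'a and s
  proof -
    have "inverse (r * s) * r = inverse s" using assms(2) by simp
    then show ?thesis by (simp only: scaleR_scaleR)
  qed
  have "(r *\<^sub>R q) /\<^sub>R (r * s) \<in> H \<longleftrightarrow> r * s = r * F ((r *\<^sub>R q) /\<^sub>R r)"
    if qs: "q \<in> N" "s \<in> J" for q s
    unfolding eq using F(6)[OF qs] assms(2) by simp
  then show ?thesis
    unfolding radial_graph_def
    using opN opJ C assms(2) F(4,5) by (intro conjI) auto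
qed

text \<open>
  Uniqueness of the scaling factor: \<open>c q\<close> divided by \<open>c F q\<close> is the point \<open>q / F q\<close> of \<open>H\<close>. The
  hypotheses on \<open>c\<close> say that \<open>c q\<close> and \<open>c F q\<close> stay in the domain of the graph.
\<close>

lemma radial_graph_homogeneous:
  assumes "radial_graph H N J F" "q \<in> N" "c *\<^sub>R q \<in> N" "c * F q \<in> J"
  shows "F (c *\<^sub>R q) = c * F q"
proof -
  note F = radial_graphD[OF assms(1)]
  have "0 < F q" "0 < c * F q" using F(4,5) assms by auto
  then have "0 < c" by (simp add: zero_less_mult_iff)
  have "q /\<^sub>R F q \<in> H" using F(4,6) assms by blast
  then have "(c *\<^sub>R q) /\<^sub>R (c * F q) \<in> H"
    using \<open>0 < c\<close> by (simp add: field_simps)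
  then show ?thesis using F(6)[OF assms(3,4)] by simp
qed

lemma radial_graph_derivative_homogeneous:
  assumes "radial_graph H N J F" "q \<in> N" "c *\<^sub>R q \<in> N" "c * F q \<in> J"
  shows "frechet_derivative F (at (c *\<^sub>R q)) w = frechet_derivative F (at q) w"
proof -
  note F = radial_graphD[OF assms(1)]
  have "0 < F q" "0 < c * F q" using F(4,5) assms by auto
  then have "0 < c" by (simp add: zero_less_mult_iff)
  have DF: "(F has_derivative frechet_derivative F (at q)) (at q)" if "q \<in> N" for q
    by (rule Ck_on_has_derivative[OF F(3) that])
  define O' where "O' = N \<inter> (\<lambda>q. (c *\<^sub>R q, c * F q)) -` (N \<times> J)"
  have "open O'"
    unfolding O'_def
    by (intro continuous_open_preimage continuous_intros Ck_on_continuous[OF F(3)] F(1,2) open_Times)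
  have "q \<in> O'" using assms by (simp add: O'_def)
  have scaled: "((\<lambda>x. F (c *\<^sub>R x)) has_derivative (\<lambda>w. frechet_derivative F (at (c *\<^sub>R q)) (c *\<^sub>R w))) (at q)"
    using has_derivative_scaleR_right[OF has_derivative_ident] DF[OF assms(3)]
    by (rule has_derivative_compose)
  have "((\<lambda>x. c * F x) has_derivative (\<lambda>w. frechet_derivative F (at (c *\<^sub>R q)) (c *\<^sub>R w))) (at q)"
    by (rule has_derivative_transform_within_open[OF scaled \<open>open O'\<close> \<open>q \<in> O'\<close>])
       (auto simp: O'_def intro: radial_graph_homogeneous[OF assms(1)])
  moreover have "((\<lambda>x. c * F x) has_derivative (\<lambda>w. c * frechet_derivative F (at q) w)) (at q)"
    by (rule has_derivative_mult_right[OF DF[OF assms(2)]])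
  ultimately have "(\<lambda>w. frechet_derivative F (at (c *\<^sub>R q)) (c *\<^sub>R w)) = (\<lambda>w. c * frechet_derivative F (at q) w)"
    by (rule has_derivative_unique)
  then have "frechet_derivative F (at (c *\<^sub>R q)) (c *\<^sub>R w) = c * frechet_derivative F (at q) w"
    by (rule fun_cong)
  then show ?thesis
    using \<open>0 < c\<close> linear_cmul[OF has_derivative_linear[OF DF[OF assms(3)]]] by simp
qed

text \<open>
  Homogeneity applies for all factors near 1, which suffices for differentiating in the factor.
\<close>

lemma radial_graph_ray:
  assumes "radial_graph H N J F" "q \<in> N"
  obtains I :: "real set" where "open I" "1 \<in> I"
    "\<And>c. c \<in> I \<Longrightarrow> c *\<^sub>R q \<in> N \<and> c * F q \<in> J"
proof -
  note F = radial_graphD[OF assms(1)]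
  have "open ((\<lambda>c. (c *\<^sub>R q, c * F q)) -` (N \<times> J))"
    by (intro open_vimage continuous_intros F(1,2) open_Times)
  then show ?thesis using that assms(2) F(4) by fastforce
qed

lemma radial_graph_Euler:
  assumes "radial_graph H N J F" "q \<in> N"
  shows "frechet_derivative F (at q) q = F q"
proof -
  obtain I where I: "open I" "1 \<in> I" "\<And>c. c \<in> I \<Longrightarrow> c *\<^sub>R q \<in> N \<and> c * F q \<in> J"
    by (rule radial_graph_ray[OF assms]) (rule that)
  have D: "(F has_derivative frechet_derivative F (at q)) (at q)"
    by (rule Ck_on_has_derivative[OF radial_graphD(3)[OF assms(1)] assms(2)])
  then have "((\<lambda>c. F (c *\<^sub>R q)) has_derivative (\<lambda>t. frechet_derivative F (at q) (t *\<^sub>R q))) (at 1)"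
    using has_derivative_compose[OF has_derivative_scaleR_left[OF has_derivative_ident], of F _ 1 q] by simp
  then have "((\<lambda>c. c * F q) has_derivative (\<lambda>t. frechet_derivative F (at q) (t *\<^sub>R q))) (at 1)"
    by (rule has_derivative_transform_within_open[OF _ I(1,2)])
       (use I(3) assms in \<open>auto intro: radial_graph_homogeneous\<close>)
  moreover have "((\<lambda>c. c * F q) has_derivative (\<lambda>t. t * F q)) (at 1)"
    by (auto intro!: derivative_eq_intros)
  ultimately have "(\<lambda>t. frechet_derivative F (at q) (t *\<^sub>R q)) = (\<lambda>t. t * F q)"
    by (rule has_derivative_unique)
  then show ?thesis by (metis mult_1 scaleR_one)
qed

text \<open>
  The tangent space is exactly the kernel of \<open>dF\<close>. A curve in \<open>H\<close> starts in the sheet of the graph and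
  hence satisfies \<open>F = 1\<close> for small times; conversely, the derivative of \<open>q \<mapsto> q / F q\<close> fixes the kernel
  of \<open>dF\<close> at points with \<open>F q = 1\<close>.
\<close>

lemma radial_graph_tangent_space:
  assumes "radial_graph H N J F" "q \<in> N" "F q = 1"
  shows "v \<in> tangent_space H q \<longleftrightarrow> frechet_derivative F (at q) v = 0"
proof
  note F = radial_graphD[OF assms(1)]
  have D: "(F has_derivative frechet_derivative F (at q)) (at q)"
    by (rule Ck_on_has_derivative[OF F(3) assms(2)])
  {
    assume "v \<in> tangent_space H q"
    then obtain \<gamma> :: "real \<Rightarrow> 'a" and \<epsilon> where "0 < \<epsilon>" and \<gamma>: "smooth_on {-\<epsilon><..<\<epsilon>} \<gamma>" "\<gamma> ` {-\<epsilon><..<\<epsilon>} \<subseteq> H"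
      and \<gamma>0: "\<gamma> 0 = q" and \<gamma>': "(\<gamma> has_vector_derivative v) (at 0)"
      unfolding tangent_space_def by blast
    have "continuous_on {-\<epsilon><..<\<epsilon>} \<gamma>"
      using \<gamma>(1) Ck_on_continuous by (auto simp: smooth_on_open)
    then have op: "open ({-\<epsilon><..<\<epsilon>} \<inter> \<gamma> -` N)"
      by (intro continuous_open_preimage F(1)) auto
    have "((\<lambda>t. F (\<gamma> t)) has_derivative (\<lambda>t. frechet_derivative F (at q) (t *\<^sub>R v))) (at 0)"
      using has_derivative_compose[of \<gamma> "\<lambda>t. t *\<^sub>R v" 0 UNIV F] \<gamma>' D \<gamma>0
      by (simp add: has_vector_derivative_def)
    then have "((\<lambda>t. 1) has_derivative (\<lambda>t. frechet_derivative F (at q) (t *\<^sub>R v))) (at 0)"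
    proof (rule has_derivative_transform_within_open[OF _ op])
      show "0 \<in> {-\<epsilon><..<\<epsilon>} \<inter> \<gamma> -` N" using \<open>0 < \<epsilon>\<close> \<gamma>0 assms(2) by simp
      fix t assume t: "t \<in> {-\<epsilon><..<\<epsilon>} \<inter> \<gamma> -` N"
      have "1 \<in> J" using F(4)[OF assms(2)] assms(3) by simp
      moreover have "\<gamma> t /\<^sub>R 1 \<in> H" using \<gamma>(2) t by auto
      ultimately show "F (\<gamma> t) = 1" using F(6)[of "\<gamma> t" 1] t by auto
    qed
    then have "(\<lambda>t. frechet_derivative F (at q) (t *\<^sub>R v)) = (\<lambda>t. 0)"
      using has_derivative_const by (rule has_derivative_unique)
    then show "frechet_derivative F (at q) v = 0" by (metis scaleR_one)
  }
  assume v: "frechet_derivative F (at q) v = 0"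
  have pos: "F q > 0" if "q \<in> N" for q using F(4,5) that by blast
  define D' where "D' v = v /\<^sub>R F q - (frechet_derivative F (at q) v / (F q)\<^sup>2) *\<^sub>R q" for v
  have "D' v \<in> tangent_space H (q /\<^sub>R F q)"
  proof (rule tangent_space_line[where D = D' and w = v and \<theta> = "\<lambda>q. q /\<^sub>R F q", OF F(1) assms(2)])
    show "Ck_on k N (\<lambda>q. q /\<^sub>R F q)" for k
      by (intro Ck_on_scaleR Ck_on_inverse F(1,3) Ck_on_linear[OF bounded_linear_ident]) (use pos in force)
    show "((\<lambda>q. q /\<^sub>R F q) has_derivative D') (at q)"
      unfolding D'_def using D pos[OF assms(2)] by (intro has_derivative_radial_projection) simp_all
    show "(q + t *\<^sub>R v) /\<^sub>R F (q + t *\<^sub>R v) \<in> H" if "q + t *\<^sub>R v \<in> N" for t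
      using F(6)[OF that F(4)[OF that]] by simp
  qed
  then show "v \<in> tangent_space H q" using v assms(3) by (simp add: D'_def)
qed

section \<open>The centroaffine metric as a Hessian\<close>

lemma has_derivative_frechet_deriv:
  assumes "\<And>k. Ck_on k N F" "q \<in> N"
  shows "((\<lambda>q. frechet_derivative F (at q) w) has_derivative
     frechet_derivative (\<lambda>q. frechet_derivative F (at q) w) (at q)) (at q)"
  by (rule Ck_on_has_derivative[OF Ck_on_deriv[OF assms(1)] assms(2)])

text \<open>
  The field \<open>X q = w - (dF\<^sub>q w / F q) q\<close> is the projection of the constant field \<open>w\<close> along the position
  vector. It is tangent to \<open>H\<close> because \<open>dF\<^sub>q q = F q\<close>. At \<open>x\<close>, where \<open>dF X = 0\<close> and \<open>F = 1\<close>, its flat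
  derivative along itself is \<open>- D\<^sup>2F (X, w) x - (dF w) X\<close>. Applying \<open>dF\<close> to the Gauss formula
  yields \<open>g (X, X) = - D\<^sup>2F (X, w)\<close>. Finally \<open>w\<close> and \<open>X x\<close> differ by a multiple of \<open>x\<close>, and
  \<open>D\<^sup>2F (x, w) = 0\<close> because \<open>dF w\<close> is constant along the ray through \<open>x\<close>.
\<close>

lemma radial_graph_hessian_normalized:
  assumes "hyperbolic_centroaffine_hypersurface H" "radial_graph H N J F" "x \<in> N" "F x = 1"
  shows "frechet_derivative (\<lambda>q. frechet_derivative F (at q) w) (at x) w \<le> 0"
proof -
  obtain g where g: "is_centroaffine_metric H g"
    and g_pos: "\<And>p v. p \<in> H \<Longrightarrow> v \<in> tangent_space H p \<Longrightarrow> v \<noteq> 0 \<Longrightarrow> 0 < g p v v"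
    using assms(1) unfolding hyperbolic_centroaffine_hypersurface_def by blast
  note F = radial_graphD[OF assms(2)]
  have pos: "F q > 0" if "q \<in> N" for q using F(4,5) that by blast
  have "1 \<in> J" using F(4)[OF assms(3)] assms(4) by simp
  have one: "F q = 1" if "q \<in> N" "q \<in> H" for q using F(6)[OF that(1) \<open>1 \<in> J\<close>] that(2) by simp
  have "x \<in> H" using F(6)[OF assms(3) \<open>1 \<in> J\<close>] assms(4) by simp
  define dF where "dF = frechet_derivative F (at x)"
  define D where "D q = frechet_derivative F (at q) w" for q
  define D' where "D' = frechet_derivative D (at x)"
  have DF: "(F has_derivative frechet_derivative F (at q)) (at q)" if "q \<in> N" for q
    by (rule Ck_on_has_derivative[OF F(3) that])
  have lin: "linear (frechet_derivative F (at q))" if "q \<in> N" for q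
    using DF[OF that] by (rule has_derivative_linear)
  have CD: "Ck_on k N D" for k
    unfolding D_def by (rule Ck_on_deriv[OF F(3)])
  have DD: "(D has_derivative D') (at x)"
    unfolding D'_def by (rule Ck_on_has_derivative[OF CD assms(3)])
  define X where "X q = w - (D q / F q) *\<^sub>R q" for q
  have CX: "Ck_on k N X" for k
  proof -
    have "Ck_on k N (\<lambda>q. w + (- 1) *\<^sub>R ((D q / F q) *\<^sub>R q))"
      by (intro Ck_on_add Ck_on_scaleR Ck_on_divide Ck_on_const F(1,3) CD Ck_on_linear[OF bounded_linear_ident])
         (use pos in force)
    then show ?thesis by (simp add: X_def[abs_def])
  qed
  have tangent: "frechet_derivative F (at q) (X q) = 0" if "q \<in> N" for q
    using pos[OF that]
    by (simp add: X_def linear_diff[OF lin[OF that]] linear_cmul[OF lin[OF that]]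
          radial_graph_Euler[OF assms(2) that] D_def)
  have field: "tangent_field H N X"
    unfolding tangent_field_def smooth_on_open[OF F(1)]
    using CX tangent one by (auto simp: radial_graph_tangent_space[OF assms(2)])
  obtain Z where Z: "Z \<in> tangent_space H x"
    and gauss: "flat_connection X X x = Z + g x (X x) (X x) *\<^sub>R x"
    using g[unfolded is_centroaffine_metric_def] F(1) field assms(3) \<open>x \<in> H\<close> by blast
  have dF0: "dF Z = 0" "dF (X x) = 0" and dFx: "dF x = 1"
    using Z tangent[OF assms(3)] radial_graph_tangent_space[OF assms(2-4)]
      radial_graph_Euler[OF assms(2,3)] assms(4) by (auto simp: dF_def)
  have "(X has_derivative (\<lambda>v. - ((D x / F x) *\<^sub>R v + ((D' v * F x - D x * dF v) / (F x * F x)) *\<^sub>R x))) (at x)"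
  proof -
    have quot: "((\<lambda>q. D q / F q) has_derivative (\<lambda>v. (D' v * F x - D x * dF v) / (F x * F x))) (at x)"
      unfolding dF_def using DD DF[OF assms(3)] by (rule has_derivative_divide') (use assms(4) in simp)
    show ?thesis
      using has_derivative_diff[OF has_derivative_const[of w]
          has_derivative_scaleR[OF quot has_derivative_ident]]
      unfolding X_def by simp
  qed
  then have "frechet_derivative X (at x) = (\<lambda>v. - ((D x / F x) *\<^sub>R v + ((D' v * F x - D x * dF v) / (F x * F x)) *\<^sub>R x))"
    by (rule frechet_derivative_at[symmetric])
  then have "flat_connection X X x = - (D x *\<^sub>R X x + D' (X x) *\<^sub>R x)"
    using dF0 assms(4) by (simp add: flat_connection_def)
  then have "dF (- (D x *\<^sub>R X x + D' (X x) *\<^sub>R x)) = dF (Z + g x (X x) (X x) *\<^sub>R x)"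
    using gauss by simp
  then have D'X: "- D' (X x) = g x (X x) (X x)"
    using lin[OF assms(3)] dF0 dFx
    by (simp add: dF_def linear_add linear_cmul linear_neg linear_diff)
  have "D' (X x) \<le> 0"
  proof (cases "X x = 0")
    case True
    then show ?thesis using linear_0[OF has_derivative_linear[OF DD]] by simp
  next
    case False
    then have "0 < g x (X x) (X x)"
      using g_pos \<open>x \<in> H\<close> field assms(3) by (auto simp: tangent_field_def)
    then show ?thesis using D'X by simp
  qed
  moreover have "D' x = 0"
  proof -
    obtain I where I: "open I" "1 \<in> I" "\<And>c. c \<in> I \<Longrightarrow> c *\<^sub>R x \<in> N \<and> c * F x \<in> J"
      by (rule radial_graph_ray[OF assms(2,3)]) (rule that)
    have "((\<lambda>c. D (c *\<^sub>R x)) has_derivative (\<lambda>t. D' (t *\<^sub>R x))) (at 1)"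
      using DD has_derivative_compose[OF has_derivative_scaleR_left[OF has_derivative_ident], of D D' 1 x] by simp
    then have "((\<lambda>c. D x) has_derivative (\<lambda>t. D' (t *\<^sub>R x))) (at 1)"
      by (rule has_derivative_transform_within_open[OF _ I(1,2)])
         (use I(3) assms in \<open>auto simp: D_def intro: radial_graph_derivative_homogeneous\<close>)
    then have "(\<lambda>t. D' (t *\<^sub>R x)) = (\<lambda>t. 0)"
      using has_derivative_const by (rule has_derivative_unique)
    then show ?thesis by (metis scaleR_one)
  qed
  moreover have "w = X x + D x *\<^sub>R x" using assms(4) by (simp add: X_def)
  ultimately have "D' w \<le> 0"
    using has_derivative_linear[OF DD] by (metis add.right_neutral linear_add linear_cmul mult_zero_right real_scaleR_def)
  then show ?thesis by (simp add: D'_def D_def[abs_def])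
qed

text \<open>
  By homogeneity the Hessian at \<open>q\<close> is a positive multiple of the Hessian at the point \<open>q / F q\<close> of \<open>H\<close>
  for the rescaled graph, where the previous lemma applies.
\<close>

lemma radial_graph_hessian:
  assumes "hyperbolic_centroaffine_hypersurface H" "radial_graph H N J F" "q \<in> N"
  shows "frechet_derivative (\<lambda>q. frechet_derivative F (at q) w) (at q) w \<le> 0"
proof -
  note F = radial_graphD[OF assms(2)]
  define r where "r = F q"
  have "r > 0" using F(4,5) assms(3) by (auto simp: r_def)
  \<comment> \<open>The rescaled graph has the value 1 at \<open>q / r\<close>.\<close>
  define F1 where "F1 x = inverse r * F (x /\<^sub>R inverse r)" for x
  define N1 where "N1 = (*\<^sub>R) (inverse r) ` N"
  have F1: "radial_graph H N1 ((*) (inverse r) ` J) F1"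
    unfolding F1_def N1_def using assms(2) \<open>r > 0\<close> by (intro radial_graph_scale) auto
  have q1: "q /\<^sub>R r \<in> N1" using assms(3) unfolding N1_def by blast
  have "F1 (q /\<^sub>R r) = 1" using \<open>r > 0\<close> by (simp add: F1_def r_def)
  then have hess: "frechet_derivative (\<lambda>q. frechet_derivative F1 (at q) w) (at (q /\<^sub>R r)) w \<le> 0"
    by (rule radial_graph_hessian_normalized[OF assms(1) F1 q1])
  have scale: "((\<lambda>x. r *\<^sub>R x) has_derivative (\<lambda>v. r *\<^sub>R v)) (at x)" for x :: 'a
    by (auto intro!: derivative_eq_intros)
  have DF1: "frechet_derivative F1 (at x) w = frechet_derivative F (at (r *\<^sub>R x)) w" if "x \<in> N1" for x
  proof -
    have "r *\<^sub>R x \<in> N" using that \<open>r > 0\<close> by (auto simp: N1_def)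
    then have D: "(F has_derivative frechet_derivative F (at (r *\<^sub>R x))) (at (r *\<^sub>R x))"
      by (rule Ck_on_has_derivative[OF F(3)])
    have "((\<lambda>x. inverse r * F (r *\<^sub>R x)) has_derivative
        (\<lambda>v. inverse r * frechet_derivative F (at (r *\<^sub>R x)) (r *\<^sub>R v))) (at x)"
      by (rule has_derivative_mult_right[OF has_derivative_compose[OF scale D]])
    then have "frechet_derivative F1 (at x) = (\<lambda>v. inverse r * frechet_derivative F (at (r *\<^sub>R x)) (r *\<^sub>R v))"
      unfolding F1_def inverse_inverse_eq by (rule frechet_derivative_at[symmetric])
    then show ?thesis
      using linear_cmul[OF has_derivative_linear[OF D]] \<open>r > 0\<close> by simp
  qed
  let ?D = "\<lambda>q. frechet_derivative F (at q) w"
  have DD: "(?D has_derivative frechet_derivative ?D (at q)) (at (r *\<^sub>R (q /\<^sub>R r)))"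
    using has_derivative_frechet_deriv[OF F(3) assms(3), of w] \<open>r > 0\<close> by simp
  have "((\<lambda>x. ?D (r *\<^sub>R x)) has_derivative (\<lambda>v. frechet_derivative ?D (at q) (r *\<^sub>R v))) (at (q /\<^sub>R r))"
    using scale DD by (rule has_derivative_compose)
  then have "((\<lambda>x. frechet_derivative F1 (at x) w) has_derivative (\<lambda>v. frechet_derivative ?D (at q) (r *\<^sub>R v))) (at (q /\<^sub>R r))"
    by (rule has_derivative_transform_within_open[OF _ radial_graphD(1)[OF F1] q1]) (simp add: DF1)
  then have "frechet_derivative (\<lambda>x. frechet_derivative F1 (at x) w) (at (q /\<^sub>R r)) w = frechet_derivative ?D (at q) (r *\<^sub>R w)"
    by (rule fun_cong[OF frechet_derivative_at[symmetric]])
  then show ?thesis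
    using hess linear_cmul[OF has_derivative_linear[OF DD]] \<open>r > 0\<close>
    by (simp add: mult_le_0_iff)
qed

section \<open>Radial sections\<close>

text \<open>
  A radial section over \<open>S\<close> amounts to a lift of \<open>S\<close> through the cone map, namely
  \<open>q \<mapsto> (\<Psi> q, q / \<Psi> q)\<close>. In contrast to \<open>radial_graph\<close> nothing confines it to a sheet other than
  continuity, so that it can be continued globally; \<open>S\<close> need not be open.
\<close>

definition radial_section :: "'a::euclidean_space set \<Rightarrow> 'a set \<Rightarrow> ('a \<Rightarrow> real) \<Rightarrow> bool" where
  "radial_section H S \<Psi> \<longleftrightarrow> continuous_on S \<Psi> \<and> (\<forall>q\<in>S. 0 < \<Psi> q \<and> q /\<^sub>R \<Psi> q \<in> H)"

lemma radial_section_subset: "radial_section H S \<Psi> \<Longrightarrow> T \<subseteq> S \<Longrightarrow> radial_section H T \<Psi>"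
  unfolding radial_section_def by (auto intro: continuous_on_subset)

lemma radial_graph_section: "radial_graph H N J F \<Longrightarrow> radial_section H N F"
  unfolding radial_section_def
  using Ck_on_continuous radial_graphD by metis

lemma radial_graph_through:
  assumes "centroaffine_hypersurface H" "0 < r" "q /\<^sub>R r \<in> H"
  obtains N J F where "radial_graph H N J F" "q \<in> N" "r \<in> J" "F q = r"
proof -
  obtain N J F where G: "radial_graph H N J F" "q /\<^sub>R r \<in> N" "1 \<in> J"
    by (rule radial_graph_exists[OF assms(1,3)]) (rule that)
  have G': "radial_graph H ((*\<^sub>R) r ` N) ((*) r ` J) (\<lambda>q. r * F (q /\<^sub>R r))"
    by (rule radial_graph_scale[OF G(1) assms(2)])
  have "q = r *\<^sub>R (q /\<^sub>R r)" using assms(2) by simp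
  then have q: "q \<in> (*\<^sub>R) r ` N" using G(2) by (rule image_eqI)
  have r: "r \<in> (*) r ` J" using image_eqI[of r "(*) r" 1 J] G(3) by simp
  have "r = r * F (q /\<^sub>R r)" using radial_graphD(6)[OF G' q r] assms(3) by simp
  then show ?thesis by (intro that[OF G' q r]) (rule sym)
qed

lemma radial_section_local:
  assumes "radial_section H S \<Psi>" "radial_graph H N J F" "q \<in> S" "q \<in> N" "\<Psi> q \<in> J"
  obtains O' where "open O'" "q \<in> O'" "O' \<subseteq> N" "\<And>z. z \<in> O' \<Longrightarrow> z \<in> S \<Longrightarrow> \<Psi> z = F z"
proof -
  note F = radial_graphD[OF assms(2)]
  have cont: "continuous_on S \<Psi>" and S: "\<And>q. q \<in> S \<Longrightarrow> q /\<^sub>R \<Psi> q \<in> H"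
    using assms(1) by (auto simp: radial_section_def)
  obtain T where T: "open T" "T \<inter> S = \<Psi> -` J \<inter> S"
    using cont F(2) unfolding continuous_on_open_invariant by blast
  show ?thesis
  proof (rule that[of "N \<inter> T"])
    show "\<Psi> z = F z" if "z \<in> N \<inter> T" "z \<in> S" for z
    proof -
      have "\<Psi> z \<in> J" using T(2) that by blast
      then show ?thesis using F(6)[of z "\<Psi> z"] S[of z] that by blast
    qed
  qed (use F(1) T assms in auto)
qed

text \<open>
  Uniqueness of lifts through a local homeomorphism: two sections that agree at a point both coincide
  with the same radial graph nearby, so the set where they agree is open as well as closed.
\<close>

lemma radial_section_unique:
  assumes "centroaffine_hypersurface H" "connected S"
    and "radial_section H S \<Psi>1" "radial_section H S \<Psi>2"
    and "a \<in> S" "\<Psi>1 a = \<Psi>2 a" "z \<in> S"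
  shows "\<Psi>1 z = \<Psi>2 z"
proof -
  define E where "E = {z \<in> S. \<Psi>1 z - \<Psi>2 z = 0}"
  have "closedin (top_of_set S) E"
    unfolding E_def using assms(3,4)
    by (intro continuous_closedin_preimage_constant continuous_intros) (auto simp: radial_section_def)
  moreover have "openin (top_of_set S) E"
  proof (subst openin_subopen, intro ballI)
    fix q assume q: "q \<in> E"
    then have qS: "q \<in> S" and eq: "\<Psi>2 q = \<Psi>1 q" by (auto simp: E_def)
    have "0 < \<Psi>1 q" "q /\<^sub>R \<Psi>1 q \<in> H" using assms(3) qS by (auto simp: radial_section_def)
    then obtain N J F where G: "radial_graph H N J F" "q \<in> N" "\<Psi>1 q \<in> J"
      by (rule radial_graph_through[OF assms(1)]) (rule that)
    obtain O1 where O1: "open O1" "q \<in> O1" "\<And>z. z \<in> O1 \<Longrightarrow> z \<in> S \<Longrightarrow> \<Psi>1 z = F z"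
      by (rule radial_section_local[OF assms(3) G(1) qS G(2,3)]) (rule that)
    have G3: "\<Psi>2 q \<in> J" using G(3) eq by simp
    obtain O2 where O2: "open O2" "q \<in> O2" "\<And>z. z \<in> O2 \<Longrightarrow> z \<in> S \<Longrightarrow> \<Psi>2 z = F z"
      by (rule radial_section_local[OF assms(4) G(1) qS G(2) G3]) (rule that)
    have "openin (top_of_set S) (S \<inter> (O1 \<inter> O2))" using O1 O2 by (intro openin_open_Int) auto
    moreover have "S \<inter> (O1 \<inter> O2) \<subseteq> E" using O1 O2 by (auto simp: E_def)
    ultimately show "\<exists>T. openin (top_of_set S) T \<and> q \<in> T \<and> T \<subseteq> E" using O1 O2 qS by blast
  qed
  ultimately have "E = {} \<or> E = S" using assms(2) by (simp add: connected_clopen)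
  then show ?thesis using assms(5-7) by (auto simp: E_def)
qed

lemma radial_section_open_local:
  assumes "centroaffine_hypersurface H" "open S" "radial_section H S \<Psi>" "q \<in> S"
  obtains N J F O' where "radial_graph H N J F" "\<Psi> q \<in> J" "open O'" "q \<in> O'" "O' \<subseteq> N \<inter> S"
    "\<And>z. z \<in> O' \<Longrightarrow> \<Psi> z = F z"
proof -
  have "0 < \<Psi> q" "q /\<^sub>R \<Psi> q \<in> H" using assms(3,4) by (auto simp: radial_section_def)
  then obtain N J F where G: "radial_graph H N J F" "q \<in> N" "\<Psi> q \<in> J"
    by (rule radial_graph_through[OF assms(1)]) (rule that)
  obtain O1 where O1: "open O1" "q \<in> O1" "O1 \<subseteq> N" "\<And>z. z \<in> O1 \<Longrightarrow> z \<in> S \<Longrightarrow> \<Psi> z = F z"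
    by (rule radial_section_local[OF assms(3) G(1) assms(4) G(2,3)]) (rule that)
  show ?thesis by (rule that[OF G(1,3), of "O1 \<inter> S"]) (use O1 assms in auto)
qed

lemma radial_section_smooth:
  assumes "centroaffine_hypersurface H" "open S" "radial_section H S \<Psi>"
  shows "Ck_on k S \<Psi>"
proof (rule Ck_on_local)
  fix q assume q: "q \<in> S"
  obtain N J F O' where G: "radial_graph H N J F" and O': "open O'" "q \<in> O'" "O' \<subseteq> N \<inter> S"
    "\<And>z. z \<in> O' \<Longrightarrow> \<Psi> z = F z"
    by (rule radial_section_open_local[OF assms q]) (rule that)
  have "Ck_on k O' \<Psi>"
    by (rule Ck_on_cong[OF O'(1) _ Ck_on_subset[OF radial_graphD(3)[OF G]]]) (use O' in auto)
  then show "\<exists>V. open V \<and> q \<in> V \<and> Ck_on k V \<Psi>" using O' by blast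
qed

lemma frechet_derivative_cong_open:
  assumes "open O'" "q \<in> O'" "\<And>z. z \<in> O' \<Longrightarrow> F z = \<Psi> z" "F differentiable (at q)"
  shows "frechet_derivative \<Psi> (at q) = frechet_derivative F (at q)"
  using frechet_derivative_transform_within_open[OF assms(4,1,2,3)] by (rule sym)

lemma radial_section_Euler:
  assumes "centroaffine_hypersurface H" "open S" "radial_section H S \<Psi>" "q \<in> S"
  shows "frechet_derivative \<Psi> (at q) q = \<Psi> q"
proof -
  obtain N J F O' where G: "radial_graph H N J F" and O': "open O'" "q \<in> O'" "O' \<subseteq> N \<inter> S"
    "\<And>z. z \<in> O' \<Longrightarrow> \<Psi> z = F z"
    by (rule radial_section_open_local[OF assms]) (rule that)
  have qN: "q \<in> N" using O' by blast
  have "frechet_derivative \<Psi> (at q) = frechet_derivative F (at q)"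
    using O' Ck_on_differentiable[OF radial_graphD(3)[OF G] qN]
    by (intro frechet_derivative_cong_open[OF O'(1,2)]) auto
  then show ?thesis using radial_graph_Euler[OF G qN] O' by simp
qed

lemma radial_section_hessian:
  assumes "hyperbolic_centroaffine_hypersurface H" "open S" "radial_section H S \<Psi>" "q \<in> S"
  shows "frechet_derivative (\<lambda>q. frechet_derivative \<Psi> (at q) w) (at q) w \<le> 0"
proof -
  have H: "centroaffine_hypersurface H"
    by (rule hyperbolic_imp_centroaffine[OF assms(1)])
  obtain N J F O' where G: "radial_graph H N J F" and O': "open O'" "q \<in> O'" "O' \<subseteq> N \<inter> S"
    "\<And>z. z \<in> O' \<Longrightarrow> \<Psi> z = F z"
    by (rule radial_section_open_local[OF H assms(2-4)]) (rule that)
  have qN: "q \<in> N" using O' by blast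
  have eq: "frechet_derivative \<Psi> (at z) = frechet_derivative F (at z)" if z: "z \<in> O'" for z
  proof (rule frechet_derivative_cong_open[OF O'(1) z])
    show "F differentiable (at z)"
      by (rule Ck_on_differentiable[OF radial_graphD(3)[OF G]]) (use O' z in blast)
  qed (use O' in auto)
  have "frechet_derivative (\<lambda>q. frechet_derivative \<Psi> (at q) w) (at q)
      = frechet_derivative (\<lambda>q. frechet_derivative F (at q) w) (at q)"
    by (rule frechet_derivative_cong_open[OF O'(1,2)])
       (simp_all add: eq Ck_on_differentiable[OF Ck_on_deriv[OF radial_graphD(3)[OF G]] qN])
  then show ?thesis using radial_graph_hessian[OF assms(1) G qN] by simp
qed

text \<open>
  The restriction of a section to a segment is concave by the Hessian estimate. With the value 1 at both
  ends, it is at least 1 in between, and its slope decreases from \<open>d\<Psi>\<^sub>x (z - x)\<close> to \<open>d\<Psi>\<^sub>z (z - x)\<close>. These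
  two slopes are rewritten by means of the Euler relation, so that each depends on the moving end point
  \<open>z\<close> in a continuous way.
\<close>

lemma radial_section_segment:
  fixes x z :: "'a::euclidean_space"
  assumes "hyperbolic_centroaffine_hypersurface H" "open S" "radial_section H S \<Psi>"
    and seg: "closed_segment x z \<subseteq> S" and "\<Psi> x = 1" "\<Psi> z = 1" and t: "0 \<le> t" "t \<le> 1"
  shows "1 \<le> \<Psi> (x + t *\<^sub>R (z - x))"
    and "frechet_derivative \<Psi> (at (x + t *\<^sub>R (z - x))) (z - x) \<le> frechet_derivative \<Psi> (at x) z - 1"
    and "1 - frechet_derivative \<Psi> (at z) x \<le> frechet_derivative \<Psi> (at (x + t *\<^sub>R (z - x))) (z - x)"
proof -
  have H: "centroaffine_hypersurface H"
    by (rule hyperbolic_imp_centroaffine[OF assms(1)])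
  define w where "w = z - x"
  define p where "p t = x + t *\<^sub>R w" for t
  define f' where "f' t = frechet_derivative \<Psi> (at (p t)) w" for t
  define f'' where "f'' t = frechet_derivative (\<lambda>q. frechet_derivative \<Psi> (at q) w) (at (p t)) w" for t
  have pS: "p t \<in> S" if "t \<in> {0..1}" for t
  proof -
    have "p t = (1 - t) *\<^sub>R x + t *\<^sub>R z" by (simp add: p_def w_def algebra_simps)
    then have "p t \<in> closed_segment x z" using that by (auto simp: in_segment)
    then show ?thesis using seg by blast
  qed
  note C = radial_section_smooth[OF H assms(2,3)]
  have DS: "(\<Psi> has_derivative frechet_derivative \<Psi> (at q)) (at q)" if "q \<in> S" for q
    by (rule Ck_on_has_derivative[OF C that])
  have chain: "((\<lambda>t. G (p t)) has_real_derivative G' w) (at t)"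
    if "(G has_derivative G') (at (p t))" for G :: "'a \<Rightarrow> real" and G' t
  proof -
    have "(p has_derivative (\<lambda>t. t *\<^sub>R w)) (at t)"
      unfolding p_def by (auto intro!: derivative_eq_intros)
    then have "((\<lambda>t. G (p t)) has_derivative (\<lambda>t. G' (t *\<^sub>R w))) (at t)"
      using that by (rule has_derivative_compose)
    moreover have "(\<lambda>t. G' (t *\<^sub>R w)) = (*) (G' w)"
      by (simp add: linear_cmul[OF has_derivative_linear[OF that]] fun_eq_iff)
    ultimately show ?thesis by (simp add: has_field_derivative_def)
  qed
  have D1: "((\<lambda>t. \<Psi> (p t)) has_real_derivative f' t) (at t)" if "t \<in> {0..1}" for t
    unfolding f'_def by (rule chain[OF DS[OF pS[OF that]]])
  have D2: "(f' has_real_derivative f'' t) (at t)" if "t \<in> {0..1}" for t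
    unfolding f'_def f''_def by (rule chain[OF has_derivative_frechet_deriv[OF C pS[OF that]]])
  have neg: "f'' t \<le> 0" if "t \<in> {0..1}" for t
    unfolding f''_def by (rule radial_section_hessian[OF assms(1-3) pS[OF that]])
  have "concave_on {0..1} (\<lambda>t. \<Psi> (p t))"
    by (rule f''_le0_imp_concave[OF _ D1 D2 neg]) auto
  then have "(1 - t) * \<Psi> (p 0) + t * \<Psi> (p 1) \<le> \<Psi> (p ((1 - t) *\<^sub>R 0 + t *\<^sub>R 1))"
    using t by (intro concave_onD) auto
  then show "1 \<le> \<Psi> (x + t *\<^sub>R (z - x))"
    using assms(5,6) by (simp add: p_def w_def)
  have mono: "f' b \<le> f' a" if "0 \<le> a" "a \<le> b" "b \<le> 1" for a b
  proof (rule DERIV_nonpos_imp_nonincreasing[OF \<open>a \<le> b\<close>])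
    fix u assume "a \<le> u" "u \<le> b"
    then show "\<exists>y. (f' has_real_derivative y) (at u) \<and> y \<le> 0"
      using D2[of u] neg[of u] that by auto
  qed
  have xz: "x \<in> S" "z \<in> S" using seg by auto
  have "f' 0 = frechet_derivative \<Psi> (at x) z - 1"
    using linear_diff[OF has_derivative_linear[OF DS[OF xz(1)]]] radial_section_Euler[OF H assms(2,3) xz(1)] assms(5)
    by (simp add: f'_def p_def w_def)
  then show "frechet_derivative \<Psi> (at (x + t *\<^sub>R (z - x))) (z - x) \<le> frechet_derivative \<Psi> (at x) z - 1"
    using mono[of 0 t] t by (simp add: f'_def p_def w_def)
  have "f' 1 = 1 - frechet_derivative \<Psi> (at z) x"
    using linear_diff[OF has_derivative_linear[OF DS[OF xz(2)]]] radial_section_Euler[OF H assms(2,3) xz(2)] assms(6)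
    by (simp add: f'_def p_def w_def)
  then show "1 - frechet_derivative \<Psi> (at z) x \<le> frechet_derivative \<Psi> (at (x + t *\<^sub>R (z - x))) (z - x)"
    using mono[of t 1] t by (simp add: f'_def p_def w_def)
qed

lemma radial_section_glue:
  assumes "open S" "open T" "radial_section H S \<Psi>1" "radial_section H T \<Psi>2"
    and "\<And>q. q \<in> S \<inter> T \<Longrightarrow> \<Psi>1 q = \<Psi>2 q"
  shows "radial_section H (S \<union> T) (\<lambda>q. if q \<in> S then \<Psi>1 q else \<Psi>2 q)"
proof -
  let ?\<Psi> = "\<lambda>q. if q \<in> S then \<Psi>1 q else \<Psi>2 q"
  have "continuous_on S ?\<Psi>" "continuous_on T ?\<Psi>"
    using assms(3-5) unfolding radial_section_def
    by (auto intro: continuous_on_eq[of S \<Psi>1] continuous_on_eq[of T \<Psi>2])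
  then have "continuous_on (S \<union> T) ?\<Psi>"
    using assms(1,2) by (intro continuous_on_open_Un)
  then show ?thesis using assms(3,4) unfolding radial_section_def by auto
qed

text \<open>
  The union of all convex open neighbourhoods of \<open>x\<close> that carry a section with value 1 at \<open>x\<close>. Two
  such sections agree on the intersection of their domains, which is convex and contains \<open>x\<close>. Their
  union is no longer convex in general, but it is starlike about \<open>x\<close>.
\<close>

lemma maximal_radial_section:
  assumes "centroaffine_hypersurface H" "x \<in> H"
  obtains L \<Phi> where "open L" "radial_section H L \<Phi>" "x \<in> L" "\<Phi> x = 1"
    "\<And>z. z \<in> L \<Longrightarrow> closed_segment x z \<subseteq> L"
    "\<And>S \<Psi>. open S \<Longrightarrow> convex S \<Longrightarrow> x \<in> S \<Longrightarrow> radial_section H S \<Psi> \<Longrightarrow> \<Psi> x = 1 \<Longrightarrow> S \<subseteq> L"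
proof -
  define P where "P S \<Psi> \<longleftrightarrow> open S \<and> convex S \<and> x \<in> S \<and> radial_section H S \<Psi> \<and> \<Psi> x = 1" for S \<Psi>
  define \<S> where "\<S> = {S. \<exists>\<Psi>. P S \<Psi>}"
  define L where "L = \<Union>\<S>"
  define \<Phi> where "\<Phi> z = (SOME r. \<exists>S \<Psi>. P S \<Psi> \<and> z \<in> S \<and> r = \<Psi> z)" for z
  have unique: "\<Psi>1 z = \<Psi>2 z" if "P S1 \<Psi>1" "P S2 \<Psi>2" "z \<in> S1" "z \<in> S2" for S1 S2 \<Psi>1 \<Psi>2 z
  proof (rule radial_section_unique[OF assms(1)])
    show "connected (S1 \<inter> S2)"
      using that unfolding P_def by (intro convex_connected convex_Int) auto
    show "radial_section H (S1 \<inter> S2) \<Psi>1" "radial_section H (S1 \<inter> S2) \<Psi>2"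
      using that unfolding P_def by (auto intro: radial_section_subset)
    show "x \<in> S1 \<inter> S2" "\<Psi>1 x = \<Psi>2 x" "z \<in> S1 \<inter> S2"
      using that unfolding P_def by auto
  qed
  have \<Phi>: "\<Phi> z = \<Psi> z" if PS: "P S \<Psi>" "z \<in> S" for S \<Psi> z
  proof -
    have "\<exists>S' \<Psi>'. P S' \<Psi>' \<and> z \<in> S' \<and> \<Phi> z = \<Psi>' z"
      unfolding \<Phi>_def by (rule someI_ex) (use PS in blast)
    then obtain S' \<Psi>' where "P S' \<Psi>'" "z \<in> S'" "\<Phi> z = \<Psi>' z" by blast
    then show ?thesis using unique[OF _ PS(1) _ PS(2)] by simp
  qed
  have sec: "radial_section H S \<Phi>" if S: "S \<in> \<S>" for S
  proof -
    obtain \<Psi> where "P S \<Psi>" using S by (auto simp: \<S>_def)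
    then have "radial_section H S \<Psi>" "\<And>z. z \<in> S \<Longrightarrow> \<Psi> z = \<Phi> z" using \<Phi> by (auto simp: P_def)
    then show ?thesis unfolding radial_section_def by (auto intro: continuous_on_eq)
  qed
  have op: "open S" "convex S" "x \<in> S" if "S \<in> \<S>" for S
    using that by (auto simp: \<S>_def P_def)
  show ?thesis
  proof (rule that[of L \<Phi>])
    show "open L" unfolding L_def using op by blast
    have "continuous_on (\<Union>S\<in>\<S>. S) \<Phi>"
      using op sec unfolding radial_section_def by (intro continuous_on_open_UN) auto
    then show "radial_section H L \<Phi>"
      using sec unfolding radial_section_def L_def by auto
    have "x /\<^sub>R 1 \<in> H" using assms(2) by simp
    then obtain N J F where G: "radial_graph H N J F" "x \<in> N" "1 \<in> J" "F x = 1"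
      by (rule radial_graph_through[OF assms(1) zero_less_one]) (rule that)
    obtain e where e: "e > 0" "ball x e \<subseteq> N"
      using radial_graphD(1)[OF G(1)] G(2) by (meson openE)
    have "P (ball x e) F"
      unfolding P_def using e G by (auto intro: radial_section_subset[OF radial_graph_section])
    moreover from this e have "ball x e \<in> \<S>" by (auto simp: \<S>_def)
    ultimately show "x \<in> L" "\<Phi> x = 1"
      using \<Phi>[of "ball x e" F x] e G unfolding L_def by (blast intro: centre_in_ball[THEN iffD2], simp)
    show "closed_segment x z \<subseteq> L" if z: "z \<in> L" for z
    proof -
      obtain S where "S \<in> \<S>" "z \<in> S" using z by (auto simp: L_def)
      then have "closed_segment x z \<subseteq> S" using op closed_segment_subset by blast
      then show ?thesis using \<open>S \<in> \<S>\<close> by (auto simp: L_def)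
    qed
    show "S \<subseteq> L" if "open S" "convex S" "x \<in> S" "radial_section H S \<Psi>" "\<Psi> x = 1" for S \<Psi>
      using that unfolding L_def \<S>_def P_def by blast
  qed
qed

lemma convex_tube:
  fixes K :: "'a::real_normed_vector set"
  assumes "convex K"
  shows "convex (\<Union>a\<in>K. ball a \<delta>)"
proof -
  have "(\<Union>b\<in>ball 0 \<delta>. {a + b}) = ball a \<delta>" for a :: 'a
    unfolding UNION_singleton_eq_range using ball_translation[of a 0 \<delta>] by simp
  then show ?thesis using convex_sums[OF assms convex_ball, of 0 \<delta>] by simp
qed

text \<open>
  Continuation of a section \<open>\<Phi>\<close> by a local graph \<open>F\<close> that agrees with it at the point \<open>b\<close>. The new domain is
  a thin tube around the segment from \<open>x\<close> to \<open>q\<close>. It is the union of a tube around the segment up to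
  \<open>b\<close>, inside \<open>L\<close>, and a tube around the rest, inside \<open>N\<close>. These two are convex, so their intersection is
  connected and contains \<open>b\<close>; therefore \<open>\<Phi>\<close> and \<open>F\<close> agree on all of it.
\<close>

lemma radial_section_extend:
  fixes x :: "'a::euclidean_space"
  assumes "centroaffine_hypersurface H" "open L" "radial_section H L \<Phi>" "\<Phi> x = 1"
    and star: "\<And>z. z \<in> L \<Longrightarrow> closed_segment x z \<subseteq> L"
    and G: "radial_graph H N J F" "q \<in> N"
    and b: "b \<in> closed_segment x q" "b \<in> L" "closed_segment b q \<subseteq> N" "\<Phi> b = F b"
  obtains S \<Psi> where "open S" "convex S" "x \<in> S" "q \<in> S" "radial_section H S \<Psi>" "\<Psi> x = 1"
proof -
  note F = radial_graphD[OF G(1)]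
  obtain \<delta>1 where d1: "\<delta>1 > 0" "(\<Union>a\<in>closed_segment x b. ball a \<delta>1) \<subseteq> L"
    by (rule compact_subset_open_imp_ball_epsilon_subset[OF compact_segment assms(2) star[OF b(2)]])
  obtain \<delta>2 where d2: "\<delta>2 > 0" "(\<Union>a\<in>closed_segment b q. ball a \<delta>2) \<subseteq> N"
    by (rule compact_subset_open_imp_ball_epsilon_subset[OF compact_segment F(1) b(3)])
  define \<delta> where "\<delta> = min \<delta>1 \<delta>2"
  define S1 where "S1 = (\<Union>a\<in>closed_segment x b. ball a \<delta>)"
  define S2 where "S2 = (\<Union>a\<in>closed_segment b q. ball a \<delta>)"
  have "\<delta> > 0" using d1 d2 by (simp add: \<delta>_def)
  have "S1 \<subseteq> L" using d1 by (force simp: S1_def \<delta>_def)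
  have "S2 \<subseteq> N" using d2 by (force simp: S2_def \<delta>_def)
  have "open S1" "open S2" by (auto simp: S1_def S2_def)
  have conv: "convex S1" "convex S2" unfolding S1_def S2_def by (intro convex_tube convex_closed_segment)+
  have "S1 \<union> S2 = (\<Union>a\<in>closed_segment x q. ball a \<delta>)"
    unfolding S1_def S2_def Un_closed_segment[OF b(1), symmetric] by blast
  then have convU: "convex (S1 \<union> S2)" by (simp add: convex_tube)
  have mem: "x \<in> S1" "b \<in> S1" "b \<in> S2" "q \<in> S2"
    using \<open>\<delta> > 0\<close>
    by (auto simp: S1_def S2_def intro: bexI[of _ x] bexI[of _ b] bexI[of _ q])
  have sec1: "radial_section H S1 \<Phi>" by (rule radial_section_subset[OF assms(3) \<open>S1 \<subseteq> L\<close>])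
  have sec2: "radial_section H S2 F"
    by (rule radial_section_subset[OF radial_graph_section[OF G(1)] \<open>S2 \<subseteq> N\<close>])
  have agree: "\<Phi> z = F z" if "z \<in> S1 \<inter> S2" for z
  proof (rule radial_section_unique[OF assms(1)])
    show "connected (S1 \<inter> S2)" by (intro convex_connected convex_Int conv)
    show "radial_section H (S1 \<inter> S2) \<Phi>" "radial_section H (S1 \<inter> S2) F"
      using sec1 sec2 by (auto intro: radial_section_subset)
  qed (use mem b that in auto)
  show ?thesis
    by (rule that[OF _ convU _ _ radial_section_glue[OF \<open>open S1\<close> \<open>open S2\<close> sec1 sec2 agree]])
       (use mem \<open>open S1\<close> \<open>open S2\<close> assms(4) in auto)
qed

section \<open>Length and completeness\<close>

text \<open>
  The fundamental theorem of calculus for the Henstock-Kurzweil integral admits finitely many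
  exceptional points. When the length is finite, the velocity is Lebesgue integrable, both integrals
  agree, and the norm can be taken inside. The set \<open>S\<close> of exceptional points is removed from the integrand
  because the value of \<open>vector_derivative\<close> is arbitrary there.
\<close>

lemma norm_diff_le_path_length:
  fixes \<gamma> :: "real \<Rightarrow> 'a::euclidean_space"
  assumes "valid_path \<gamma>"
  shows "ennreal (norm (pathfinish \<gamma> - pathstart \<gamma>)) \<le> path_length \<gamma>"
proof (cases "path_length \<gamma> = \<infinity>")
  case True
  then show ?thesis by simp
next
  case False
  let ?D = "\<lambda>t. vector_derivative \<gamma> (at t)"
  obtain S where S: "finite S" "\<gamma> C1_differentiable_on ({0..1} - S)" and cont: "continuous_on {0..1} \<gamma>"
    using assms unfolding valid_path_def piecewise_C1_differentiable_on_def by blast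
  have diff: "\<gamma> differentiable (at t)" if "t \<in> {0..1} - S" for t
    using S(2) that by (auto simp: C1_differentiable_on_eq)
  have contD: "continuous_on ({0..1} - S) ?D"
    using S(2) by (simp add: C1_differentiable_on_eq)
  have integral: "(?D has_integral (\<gamma> 1 - \<gamma> 0)) {0..1}"
  proof (rule fundamental_theorem_of_calculus_interior_strong[OF S(1)])
    show "(\<gamma> has_vector_derivative ?D t) (at t)" if "t \<in> {0<..<1} - S" for t
      using diff[of t] that by (auto simp: vector_derivative_works)
  qed (use cont in auto)
  define E where "E t = indicator ({0..1} - S) t *\<^sub>R ?D t" for t
  have "{0..1} - S \<in> sets borel"
    using S(1) by (intro sets.Diff) (auto simp: finite_imp_closed borel_closed)
  then have meas: "E \<in> borel_measurable borel"
    unfolding E_def using contD by (rule borel_measurable_continuous_on_indicator)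
  have ae: "AE t in lborel. t \<notin> S"
    by (rule AE_not_in) (simp add: S(1) finite_imp_null_set_lborel)
  have len: "(\<integral>\<^sup>+ t. ennreal (norm (E t)) \<partial>lborel) = path_length \<gamma>"
    unfolding path_length_def
    by (rule nn_integral_cong_AE) (use ae in \<open>auto simp: E_def indicator_def\<close>)
  have intE: "integrable lborel E"
  proof (rule integrableI_bounded)
    show "E \<in> borel_measurable lborel" using meas by simp
    show "(\<integral>\<^sup>+ t. ennreal (norm (E t)) \<partial>lborel) < \<infinity>"
      unfolding len using False by (simp add: less_top[symmetric])
  qed
  have "(E has_integral (\<gamma> 1 - \<gamma> 0)) UNIV"
  proof -
    have "((\<lambda>t. if t \<in> {0..1} then ?D t else 0) has_integral (\<gamma> 1 - \<gamma> 0)) UNIV"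
      using integral by (simp only: has_integral_restrict_UNIV)
    then show ?thesis
      by (rule has_integral_spike_finite[OF S(1), rotated]) (auto simp: E_def indicator_def)
  qed
  then have "\<gamma> 1 - \<gamma> 0 = integral\<^sup>L lborel E"
    using has_integral_integral_lborel[OF intE] by (rule has_integral_unique)
  then have "norm (\<gamma> 1 - \<gamma> 0) \<le> (\<integral>t. norm (E t) \<partial>lborel)"
    using integral_norm_bound[of lborel E] by simp
  then have "ennreal (norm (\<gamma> 1 - \<gamma> 0)) \<le> ennreal (\<integral>t. norm (E t) \<partial>lborel)"
    by (rule ennreal_leI)
  also have "\<dots> = path_length \<gamma>"
    using nn_integral_eq_integral[of lborel "\<lambda>t. norm (E t)"] intE len by simp
  finally show ?thesis by (simp add: pathfinish_def pathstart_def)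
qed

lemma norm_diff_le_induced_dist: "ennreal (norm (y - x)) \<le> induced_dist H x y"
  unfolding induced_dist_def
  using norm_diff_le_path_length by (intro INF_greatest) auto

lemma induced_dist_curve_le:
  fixes c :: "real \<Rightarrow> 'a::euclidean_space"
  assumes "\<And>t. t \<in> I \<Longrightarrow> c t \<in> H" "\<And>t. t \<in> I \<Longrightarrow> (c has_vector_derivative c' t) (at t)"
    and "continuous_on I c'" "\<And>t. t \<in> I \<Longrightarrow> norm (c' t) \<le> K" "closed_segment a b \<subseteq> I"
  shows "induced_dist H (c a) (c b) \<le> ennreal (K * \<bar>b - a\<bar>)"
proof -
  define \<gamma> where "\<gamma> u = c (a + u * (b - a))" for u
  have I: "a + u * (b - a) \<in> I" if "u \<in> {0..1}" for u
  proof -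
    have "a + u * (b - a) = (1 - u) *\<^sub>R a + u *\<^sub>R b" by (simp add: algebra_simps)
    then show ?thesis using that assms(5) by (force simp: closed_segment_def)
  qed
  have D: "(\<gamma> has_vector_derivative (b - a) *\<^sub>R c' (a + u * (b - a))) (at u)" if "u \<in> {0..1}" for u
  proof -
    have "((\<lambda>u. a + u * (b - a)) has_vector_derivative (b - a)) (at u)"
      by (auto intro!: derivative_eq_intros simp: has_real_derivative_iff_has_vector_derivative[symmetric])
    then show ?thesis
      using vector_diff_chain_at[of "\<lambda>u. a + u * (b - a)" "b - a" u c] assms(2)[OF I[OF that]]
      by (simp add: \<gamma>_def[abs_def] o_def)
  qed
  have "\<gamma> C1_differentiable_on {0..1}"
    unfolding C1_differentiable_on_def
  proof (intro exI conjI ballI)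
    show "continuous_on {0..1} (\<lambda>u. (b - a) *\<^sub>R c' (a + u * (b - a)))"
      by (intro continuous_intros continuous_on_compose2[OF assms(3)]) (use I in auto)
  qed (rule D)
  then have "valid_path \<gamma>" by (simp add: valid_path_def C1_differentiable_imp_piecewise)
  moreover have "path_image \<gamma> \<subseteq> H" using I assms(1) by (auto simp: path_image_def \<gamma>_def)
  ultimately have "induced_dist H (c a) (c b) \<le> path_length \<gamma>"
    unfolding induced_dist_def by (intro INF_lower) (simp add: pathstart_def pathfinish_def \<gamma>_def)
  also have "path_length \<gamma> \<le> (\<integral>\<^sup>+ t. ennreal (K * \<bar>b - a\<bar>) * indicator {0..1::real} t \<partial>lborel)"
    unfolding path_length_def
  proof (rule nn_integral_mono)
    fix t :: real
    have "norm (vector_derivative \<gamma> (at t)) \<le> K * \<bar>b - a\<bar>" if t: "t \<in> {0..1}"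
      using vector_derivative_at[OF D[OF t]] mult_right_mono[OF assms(4)[OF I[OF t]], of "\<bar>b - a\<bar>"]
      by (simp add: mult.commute)
    then show "ennreal (norm (vector_derivative \<gamma> (at t))) * indicator {0..1} t
        \<le> ennreal (K * \<bar>b - a\<bar>) * indicator {0..1} t"
      by (auto simp: indicator_def intro: ennreal_leI)
  qed
  also have "\<dots> = ennreal (K * \<bar>b - a\<bar>)"
    by (simp add: nn_integral_cmult_indicator)
  finally show ?thesis .
qed

text \<open>
  Completeness in the form that fits the continuation of sections: a curve of bounded speed on a half-open interval
  converges to a point of \<open>H\<close>. Completeness applies to the points at a sequence of times increasing
  to \<open>s\<close>; as the curve is Lipschitz, the limit along this sequence is a limit of the curve.
\<close>

lemma euclidean_complete_curve_limit:
  fixes c :: "real \<Rightarrow> 'a::euclidean_space"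
  assumes "euclidean_complete H" "a < s"
    and c: "\<And>t. t \<in> {a..<s} \<Longrightarrow> c t \<in> H" "\<And>t. t \<in> {a..<s} \<Longrightarrow> (c has_vector_derivative c' t) (at t)"
      "continuous_on {a..<s} c'" "\<And>t. t \<in> {a..<s} \<Longrightarrow> norm (c' t) \<le> K"
  obtains h where "h \<in> H" "(c \<longlongrightarrow> h) (at_left s)"
proof -
  have "0 \<le> K" by (rule order.trans[OF norm_ge_zero c(4)[of a]]) (use assms(2) in simp)
  have dist: "induced_dist H (c u) (c v) \<le> ennreal (K * \<bar>v - u\<bar>)" if "u \<in> {a..<s}" "v \<in> {a..<s}" for u v
    by (rule induced_dist_curve_le[OF c]) (use that in \<open>auto simp: closed_segment_eq_real_ivl split: if_splits\<close>)
  define \<tau> where "\<tau> i = s - (s - a) / real (Suc i)" for i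
  have \<tau>: "\<tau> i \<in> {a..<s}" for i
  proof -
    have "(s - a) / real (Suc i) \<le> s - a" "0 < (s - a) / real (Suc i)"
      using assms(2) by (simp_all add: divide_le_eq mult_le_cancel_left1)
    then show ?thesis by (simp add: \<tau>_def)
  qed
  have "(\<lambda>i. (s - a) * inverse (real (Suc i))) \<longlonglongrightarrow> (s - a) * 0"
    by (intro tendsto_intros LIMSEQ_inverse_real_of_nat)
  then have \<tau>_lim: "\<tau> \<longlonglongrightarrow> s"
    unfolding \<tau>_def divide_inverse using tendsto_diff[OF tendsto_const, of _ "0" sequentially s] by simp
  have "\<exists>N. \<forall>i\<ge>N. \<forall>j\<ge>N. induced_dist H (c (\<tau> i)) (c (\<tau> j)) < \<epsilon>" if \<epsilon>: "\<epsilon> > 0" for \<epsilon> :: ennreal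
  proof -
    obtain \<epsilon>' where \<epsilon>': "0 < \<epsilon>'" "\<epsilon>' < \<epsilon>" using dense[OF \<epsilon>] by blast
    define e where "e = enn2real \<epsilon>'"
    have "\<epsilon>' < top" using \<epsilon>'(2) by (rule order.strict_trans2) simp
    then have e: "ennreal e = \<epsilon>'" and "e > 0"
      using \<epsilon>'(1) by (auto simp: e_def enn2real_positive_iff)
    have "Cauchy \<tau>" using \<tau>_lim by (rule LIMSEQ_imp_Cauchy)
    then obtain N where N: "\<And>i j. i \<ge> N \<Longrightarrow> j \<ge> N \<Longrightarrow> dist (\<tau> i) (\<tau> j) < e / (K + 1)"
      unfolding Cauchy_def using \<open>e > 0\<close> \<open>0 \<le> K\<close> by (metis add_nonneg_pos divide_pos_pos zero_less_one)
    have "induced_dist H (c (\<tau> i)) (c (\<tau> j)) < \<epsilon>" if "i \<ge> N" "j \<ge> N" for i j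
    proof -
      have "K * \<bar>\<tau> j - \<tau> i\<bar> \<le> (K + 1) * (e / (K + 1))"
        using N[OF that] \<open>0 \<le> K\<close> by (intro mult_mono) (auto simp: dist_real_def abs_minus_commute)
      then have "K * \<bar>\<tau> j - \<tau> i\<bar> \<le> e" using \<open>0 \<le> K\<close> by simp
      then show ?thesis
        using order.trans[OF dist[OF \<tau> \<tau>, of i j] ennreal_leI] \<epsilon>'(2) e
        by (metis order_le_less_trans)
    qed
    then show ?thesis by blast
  qed
  then obtain h where "h \<in> H" and conv: "(\<lambda>i. induced_dist H (c (\<tau> i)) h) \<longlonglongrightarrow> 0"
    using assms(1)[unfolded euclidean_complete_def, rule_format, of "\<lambda>i. c (\<tau> i)"] c(1)[OF \<tau>] by blast
  have "(\<lambda>i. ennreal (norm (h - c (\<tau> i)))) \<longlonglongrightarrow> 0"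
    by (rule tendsto_sandwich[OF _ _ tendsto_const conv]) (auto simp: norm_diff_le_induced_dist)
  then have "(\<lambda>i. norm (h - c (\<tau> i))) \<longlonglongrightarrow> 0"
    by (simp add: ennreal_0[symmetric] del: ennreal_0)
  then have seq: "(\<lambda>i. c (\<tau> i)) \<longlonglongrightarrow> h"
    by (simp add: tendsto_norm_zero_iff LIM_zero_iff norm_minus_commute[of h])
  have lip: "norm (c v - c u) \<le> K * \<bar>v - u\<bar>" if "u \<in> {a..<s}" "v \<in> {a..<s}" for u v
  proof -
    have "ennreal (norm (c v - c u)) \<le> ennreal (K * \<bar>v - u\<bar>)"
      using norm_diff_le_induced_dist dist[OF that] by (rule order.trans)
    then show ?thesis using \<open>0 \<le> K\<close> by (simp add: ennreal_le_iff)
  qed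
  have lim_bound: "norm (h - c u) \<le> K * (s - u)" if u: "u \<in> {a..<s}" for u
  proof (rule LIMSEQ_le[of "\<lambda>i. norm (c (\<tau> i) - c u)" _ "\<lambda>i. K * \<bar>\<tau> i - u\<bar>"])
    show "(\<lambda>i. norm (c (\<tau> i) - c u)) \<longlonglongrightarrow> norm (h - c u)" by (intro tendsto_intros seq)
    have "(\<lambda>i. K * \<bar>\<tau> i - u\<bar>) \<longlonglongrightarrow> K * \<bar>s - u\<bar>" by (intro tendsto_intros \<tau>_lim)
    then show "(\<lambda>i. K * \<bar>\<tau> i - u\<bar>) \<longlonglongrightarrow> K * (s - u)" using u by simp
  qed (use lip[OF u \<tau>] in auto)
  have "(c \<longlongrightarrow> h) (at_left s)"
  proof (rule LIM_zero_cancel, rule Lim_null_comparison)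
    show "\<forall>\<^sub>F u in at_left s. norm (c u - h) \<le> K * (s - u)"
      using eventually_at_left_real[OF assms(2)]
      by eventually_elim (use lim_bound in \<open>auto simp: norm_minus_commute\<close>)
    have "((\<lambda>u. K * (s - u)) \<longlongrightarrow> K * (s - s)) (at_left s)" by (intro tendsto_intros)
    then show "((\<lambda>u. K * (s - u)) \<longlongrightarrow> 0) (at_left s)" by simp
  qed
  then show ?thesis using that \<open>h \<in> H\<close> by blast
qed

section \<open>Continuing sections along segments\<close>

lemma segment_in_starlike_open:
  fixes x y :: "'a::euclidean_space"
  assumes "open L" "x \<in> L" "\<not> closed_segment x y \<subseteq> L"
  obtains s where "0 < s" "s \<le> 1" "x + s *\<^sub>R (y - x) \<notin> L"
    "\<And>t. 0 \<le> t \<Longrightarrow> t < s \<Longrightarrow> x + t *\<^sub>R (y - x) \<in> L"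
proof -
  define p where "p t = x + t *\<^sub>R (y - x)" for t
  define B where "B = {0..1} \<inter> p -` (- L)"
  have "closed B"
    unfolding B_def p_def using assms(1)
    by (intro closed_Int closed_vimage continuous_intros) auto
  then have "compact B" unfolding B_def by (simp add: compact_eq_bounded_closed bounded_Int)
  have "B \<noteq> {}"
  proof -
    obtain z where "z \<in> closed_segment x y" "z \<notin> L" using assms(3) by blast
    then obtain u where "0 \<le> u" "u \<le> 1" "z = (1 - u) *\<^sub>R x + u *\<^sub>R y" by (auto simp: in_segment)
    moreover from this have "z = p u" by (simp add: p_def algebra_simps)
    ultimately have "u \<in> B" using \<open>z \<notin> L\<close> by (auto simp: B_def)
    then show ?thesis by blast
  qed
  obtain s where s: "s \<in> B" "\<And>t. t \<in> B \<Longrightarrow> s \<le> t"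
    using compact_attains_inf[OF \<open>compact B\<close> \<open>B \<noteq> {}\<close>] by blast
  have "s \<noteq> 0" using s(1) assms(2) by (auto simp: B_def p_def)
  moreover have "p t \<in> L" if t: "0 \<le> t" "t < s" for t
    using s(1) s(2)[of t] t by (force simp: B_def)
  ultimately show ?thesis using that[of s] s(1) by (auto simp: B_def p_def)
qed

lemma frechet_derivative_tendsto:
  fixes \<Phi> :: "'a::euclidean_space \<Rightarrow> real"
  assumes "open L" "\<And>k. Ck_on k L \<Phi>" "q \<in> L" "(u \<longlongrightarrow> q) F" "(v \<longlongrightarrow> w) F"
  shows "((\<lambda>i. frechet_derivative \<Phi> (at (u i)) (v i)) \<longlongrightarrow> frechet_derivative \<Phi> (at q) w) F"
proof -
  have lin: "linear (frechet_derivative \<Phi> (at z))" if "z \<in> L" for z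
    using Ck_on_has_derivative[OF assms(2) that] by (rule has_derivative_linear)
  have cont: "isCont (\<lambda>z. frechet_derivative \<Phi> (at z) b) q" for b
    using Ck_on_continuous[OF Ck_on_deriv[OF assms(2)]] assms(1,3) continuous_on_eq_continuous_at by blast
  have "((\<lambda>i. \<Sum>b\<in>Basis. (v i \<bullet> b) *\<^sub>R frechet_derivative \<Phi> (at (u i)) b) \<longlongrightarrow>
      (\<Sum>b\<in>Basis. (w \<bullet> b) *\<^sub>R frechet_derivative \<Phi> (at q) b)) F"
    by (intro tendsto_intros assms(5) isCont_tendsto_compose[OF cont assms(4)])
  moreover have "\<forall>\<^sub>F i in F. u i \<in> L"
    using assms(4,1,3) by (rule topological_tendstoD)
  then have "\<forall>\<^sub>F i in F. (\<Sum>b\<in>Basis. (v i \<bullet> b) *\<^sub>R frechet_derivative \<Phi> (at (u i)) b)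
      = frechet_derivative \<Phi> (at (u i)) (v i)"
    by eventually_elim (rule linear_sum_Basis[OF lin, symmetric])
  ultimately have "((\<lambda>i. frechet_derivative \<Phi> (at (u i)) (v i)) \<longlongrightarrow>
      (\<Sum>b\<in>Basis. (w \<bullet> b) *\<^sub>R frechet_derivative \<Phi> (at q) b)) F"
    by (rule Lim_transform_eventually)
  then show ?thesis by (simp only: linear_sum_Basis[OF lin[OF assms(3)], of w])
qed

text \<open>
  Suppose that the segment from \<open>x\<close> to \<open>y\<close> leaves \<open>L\<close> for the first time at the parameter \<open>s\<close>. Up to
  there, the projection \<open>c\<close> of the segment to \<open>H\<close> has bounded speed: \<open>f \<ge> 1\<close> prevents it from running
  off to infinity and the bound on \<open>f'\<close> controls its velocity. So \<open>c\<close> has a limit \<open>h\<close> in \<open>H\<close>. As \<open>h\<close> is not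
  zero, \<open>f = |p| / |c|\<close> converges too, which places the point \<open>p s\<close> on the ray through \<open>h\<close>. The
  local graph there continues \<open>\<Phi>\<close> beyond \<open>s\<close>, against the maximality of \<open>L\<close>.
\<close>

lemma radial_section_reaches_limit:
  fixes x y :: "'a::euclidean_space"
  assumes "hyperbolic_centroaffine_hypersurface H" "euclidean_complete H"
    and "open L" "radial_section H L \<Phi>" "x \<in> L" "\<Phi> x = 1"
    and star: "\<And>z. z \<in> L \<Longrightarrow> closed_segment x z \<subseteq> L"
    and max: "\<And>S \<Psi>. open S \<Longrightarrow> convex S \<Longrightarrow> x \<in> S \<Longrightarrow> radial_section H S \<Psi> \<Longrightarrow> \<Psi> x = 1 \<Longrightarrow> S \<subseteq> L"
    and bounds: "\<And>t. 0 \<le> t \<Longrightarrow> t < 1 \<Longrightarrow> x + t *\<^sub>R (y - x) \<in> L \<Longrightarrow>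
        1 \<le> \<Phi> (x + t *\<^sub>R (y - x)) \<and> \<bar>frechet_derivative \<Phi> (at (x + t *\<^sub>R (y - x))) (y - x)\<bar> \<le> C"
  shows "y \<in> L"
proof (rule ccontr)
  have H: "centroaffine_hypersurface H"
    by (rule hyperbolic_imp_centroaffine[OF assms(1)])
  assume "y \<notin> L"
  then have "\<not> closed_segment x y \<subseteq> L" by auto
  then obtain s where s: "0 < s" "s \<le> 1" "x + s *\<^sub>R (y - x) \<notin> L"
    and sL: "\<And>t. 0 \<le> t \<Longrightarrow> t < s \<Longrightarrow> x + t *\<^sub>R (y - x) \<in> L"
    by (rule segment_in_starlike_open[OF assms(3,5)]) (rule that)
  define w where "w = y - x"
  define p where "p t = x + t *\<^sub>R w" for t
  define f where "f t = \<Phi> (p t)" for t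
  define f' where "f' t = frechet_derivative \<Phi> (at (p t)) w" for t
  define c where "c t = p t /\<^sub>R f t" for t
  define c' where "c' t = w /\<^sub>R f t - (f' t / (f t)\<^sup>2) *\<^sub>R p t" for t
  have pL: "p t \<in> L" if "t \<in> {0..<s}" for t using sL[of t] that by (simp add: p_def w_def)
  have f1: "1 \<le> f t" and f'C: "\<bar>f' t\<bar> \<le> C" if "t \<in> {0..<s}" for t
    using bounds[of t] sL[of t] that s(2) by (auto simp: p_def w_def f_def f'_def)
  note C\<Phi> = radial_section_smooth[OF H assms(3,4)]
  have cH: "c t \<in> H" if "t \<in> {0..<s}" for t
    using assms(4) pL[OF that] by (simp add: radial_section_def c_def f_def)
  have p_cont: "continuous_on T p" for T unfolding p_def by (intro continuous_intros)
  have c_deriv: "(c has_vector_derivative c' t) (at t)" if t: "t \<in> {0..<s}" for t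
  proof -
    have D: "(\<Phi> has_derivative frechet_derivative \<Phi> (at (p t))) (at (p t))"
      by (rule Ck_on_has_derivative[OF C\<Phi> pL[OF t]])
    have "((\<lambda>q. q /\<^sub>R \<Phi> q) has_derivative
        (\<lambda>v. v /\<^sub>R \<Phi> (p t) - (frechet_derivative \<Phi> (at (p t)) v / (\<Phi> (p t))\<^sup>2) *\<^sub>R p t)) (at (p t))"
      by (rule has_derivative_radial_projection[OF D]) (use f1[OF t] in \<open>simp add: f_def\<close>)
    moreover have "(p has_vector_derivative w) (at t)"
      unfolding p_def by (auto intro!: derivative_eq_intros)
    ultimately have "((\<lambda>q. q /\<^sub>R \<Phi> q) \<circ> p has_vector_derivative
        (w /\<^sub>R \<Phi> (p t) - (frechet_derivative \<Phi> (at (p t)) w / (\<Phi> (p t))\<^sup>2) *\<^sub>R p t)) (at t)"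
      by (rule vector_derivative_diff_chain_within[OF _ has_derivative_at_withinI, rotated])
    then show ?thesis by (simp add: c_def[abs_def] c'_def f_def f'_def o_def)
  qed
  have f_cont: "continuous_on {0..<s} f"
    unfolding f_def
    by (rule continuous_on_compose2[OF Ck_on_continuous[OF C\<Phi>] p_cont]) (use pL in auto)
  have f'_cont: "continuous_on {0..<s} f'"
    unfolding f'_def
    by (rule continuous_on_compose2[OF Ck_on_continuous[OF Ck_on_deriv[OF C\<Phi>]] p_cont]) (use pL in auto)
  have c'_cont: "continuous_on {0..<s} c'"
    unfolding c'_def by (intro continuous_intros f_cont f'_cont p_cont) (use f1 in force)+
  have c'_bound: "norm (c' t) \<le> norm w + C * (norm x + norm w)" if t: "t \<in> {0..<s}" for t
  proof -
    have "norm (w /\<^sub>R f t) \<le> norm w"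
      using f1[OF t] by (simp add: divide_inverse[symmetric] divide_le_eq mult_le_cancel_left1 mult.commute)
    moreover have "norm ((f' t / (f t)\<^sup>2) *\<^sub>R p t) \<le> C * (norm x + norm w)"
    proof -
      have "norm (p t) \<le> norm x + norm (t *\<^sub>R w)" unfolding p_def by (rule norm_triangle_ineq)
      also have "norm (t *\<^sub>R w) \<le> 1 * norm w"
        unfolding norm_scaleR using t s(2) by (intro mult_right_mono) auto
      finally have "norm (p t) \<le> norm x + norm w" by simp
      moreover have "\<bar>f' t / (f t)\<^sup>2\<bar> \<le> C"
      proof -
        have "1 \<le> (f t)\<^sup>2" using f1[OF t] by (simp add: one_le_power)
        then have "\<bar>f' t\<bar> / (f t)\<^sup>2 \<le> \<bar>f' t\<bar> / 1" by (intro divide_left_mono) auto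
        then show ?thesis using f'C[OF t] by (simp add: abs_divide)
      qed
      ultimately show ?thesis
        unfolding norm_scaleR real_norm_def
        by (intro mult_mono order.trans[OF abs_ge_zero f'C[OF t]]) auto
    qed
    ultimately show ?thesis
      unfolding c'_def using norm_triangle_ineq4 by (meson add_mono order.trans)
  qed
  obtain h where "h \<in> H" and c_lim: "(c \<longlongrightarrow> h) (at_left s)"
    by (rule euclidean_complete_curve_limit[OF assms(2) s(1) cH c_deriv c'_cont c'_bound]) (auto intro: that)
  have ev: "\<forall>\<^sub>F t in at_left s. t \<in> {0<..<s}" by (rule eventually_at_left_real[OF s(1)])
  have nontriv: "at_left s \<noteq> bot" by (rule trivial_limit_at_left_real)
  have p_lim: "(p \<longlongrightarrow> p s) (at_left s)" unfolding p_def by (intro tendsto_intros)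
  have "h \<noteq> 0" by (rule centroaffine_nonzero[OF H \<open>h \<in> H\<close>])
  define \<rho> where "\<rho> = norm (p s) / norm h"
  have f_lim: "(f \<longlongrightarrow> \<rho>) (at_left s)"
  proof (rule Lim_transform_eventually)
    show "((\<lambda>t. norm (p t) / norm (c t)) \<longlongrightarrow> \<rho>) (at_left s)"
      unfolding \<rho>_def using \<open>h \<noteq> 0\<close> by (intro tendsto_intros p_lim c_lim) auto
    show "\<forall>\<^sub>F t in at_left s. norm (p t) / norm (c t) = f t"
      using ev
    proof eventually_elim
      case (elim t)
      then have t: "t \<in> {0..<s}" by auto
      have "p t \<noteq> 0" using centroaffine_nonzero[OF H cH[OF t]] by (auto simp: c_def)
      then show ?case using f1[OF t] by (simp add: c_def field_simps)
    qed
  qed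
  have "1 \<le> \<rho>"
    by (rule tendsto_lowerbound[OF f_lim _ nontriv]) (use ev in eventually_elim, use f1 in auto)
  have "(c \<longlongrightarrow> p s /\<^sub>R \<rho>) (at_left s)"
    unfolding c_def using \<open>1 \<le> \<rho>\<close> by (intro tendsto_intros p_lim f_lim) auto
  then have "p s /\<^sub>R \<rho> = h" using c_lim nontriv by (metis tendsto_unique)
  then have "0 < \<rho>" "p s /\<^sub>R \<rho> \<in> H" using \<open>1 \<le> \<rho>\<close> \<open>h \<in> H\<close> by auto
  then obtain N J F where G: "radial_graph H N J F" "p s \<in> N" "\<rho> \<in> J"
    by (rule radial_graph_through[OF H]) (rule that)
  obtain e where e: "e > 0" "ball (p s) e \<subseteq> N"
    using radial_graphD(1)[OF G(1)] G(2) by (meson openE)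
  have "\<forall>\<^sub>F t in at_left s. f t \<in> J"
    using f_lim radial_graphD(2)[OF G(1)] G(3) by (rule topological_tendstoD)
  moreover have "\<forall>\<^sub>F t in at_left s. p t \<in> ball (p s) e"
    using p_lim open_ball by (rule topological_tendstoD) (use e in simp)
  ultimately have "\<forall>\<^sub>F t in at_left s. t \<in> {0..<s} \<and> f t \<in> J \<and> p t \<in> ball (p s) e"
    using ev by eventually_elim auto
  then obtain t where t: "t \<in> {0..<s}" "f t \<in> J" "p t \<in> ball (p s) e"
    using eventually_happens'[OF nontriv] by blast
  have \<Phi>F: "\<Phi> (p t) = F (p t)"
    using radial_graphD(6)[OF G(1) _ t(2), of "p t"] cH[OF t(1)] t(3) e by (auto simp: c_def f_def)
  have "p t = (1 - t / s) *\<^sub>R x + (t / s) *\<^sub>R p s"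
    using s(1) by (simp add: p_def algebra_simps)
  then have seg1: "p t \<in> closed_segment x (p s)"
    using t(1) s(1) by (auto simp: in_segment intro!: exI[of _ "t / s"])
  have seg2: "closed_segment (p t) (p s) \<subseteq> N"
    using closed_segment_subset[OF t(3) _ convex_ball, of "p s"] e by auto
  obtain S \<Psi> where "open S" "convex S" "x \<in> S" "p s \<in> S" "radial_section H S \<Psi>" "\<Psi> x = 1"
    by (rule radial_section_extend[OF H assms(3,4,6) star G(1,2) seg1 pL[OF t(1)] seg2 \<Phi>F])
      (assumption, rule that)
  then have "p s \<in> L" using max by blast
  then show False using s(3) by (simp add: p_def w_def)
qed

text \<open>
  The set \<open>A\<close> of points that can be joined to \<open>x\<close> is open and closed in \<open>H\<close>. For closedness, the slope of
  the section at the moving end point \<open>a i\<close> is read off from the fixed local graph \<open>F\<close> around the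
  limit \<open>z\<close>. Both slopes then converge with \<open>i\<close>, which makes them bounded uniformly in \<open>i\<close>.
\<close>

lemma radial_section_joins_points:
  fixes x y :: "'a::euclidean_space"
  assumes "hyperbolic_centroaffine_hypersurface H" "euclidean_complete H" "connected H" "x \<in> H" "y \<in> H"
  obtains S \<Psi> where "open S" "closed_segment x y \<subseteq> S" "radial_section H S \<Psi>" "\<Psi> x = 1" "\<Psi> y = 1"
proof -
  have H: "centroaffine_hypersurface H"
    by (rule hyperbolic_imp_centroaffine[OF assms(1)])
  obtain L \<Phi> where L: "open L" "radial_section H L \<Phi>" "x \<in> L" "\<Phi> x = 1"
    and star: "\<And>z. z \<in> L \<Longrightarrow> closed_segment x z \<subseteq> L"
    and max: "\<And>S \<Psi>. open S \<Longrightarrow> convex S \<Longrightarrow> x \<in> S \<Longrightarrow> radial_section H S \<Psi> \<Longrightarrow> \<Psi> x = 1 \<Longrightarrow> S \<subseteq> L"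
    by (rule maximal_radial_section[OF H assms(4)]) (rule that)
  note C\<Phi> = radial_section_smooth[OF H L(1,2)]
  have cont: "continuous_on L \<Phi>" using L(2) by (simp add: radial_section_def)
  define A where "A = {z \<in> H. z \<in> L \<and> \<Phi> z = 1}"
  have "openin (top_of_set H) A"
  proof (subst openin_subopen, intro ballI)
    fix z assume z: "z \<in> A"
    then have zL: "z \<in> L" by (simp add: A_def)
    obtain N J F O' where G: "radial_graph H N J F" "\<Phi> z \<in> J" and O': "open O'" "z \<in> O'" "O' \<subseteq> N \<inter> L"
      "\<And>u. u \<in> O' \<Longrightarrow> \<Phi> u = F u"
      by (rule radial_section_open_local[OF H L(1,2) zL]) (rule that)
    have "1 \<in> J" using G(2) z by (simp add: A_def)
    have "H \<inter> O' \<subseteq> A"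
    proof
      fix u assume u: "u \<in> H \<inter> O'"
      \<comment> \<open>Points of \<open>H\<close> have scaling factor 1, which is in \<open>J\<close> because \<open>\<Phi> z = 1\<close>.\<close>
      then have "1 = F u" using radial_graphD(6)[OF G(1) _ \<open>1 \<in> J\<close>, of u] O' by auto
      then show "u \<in> A" using O' u by (auto simp: A_def)
    qed
    moreover have "openin (top_of_set H) (H \<inter> O')" using O'(1) by (rule openin_open_Int)
    ultimately show "\<exists>T. openin (top_of_set H) T \<and> z \<in> T \<and> T \<subseteq> A" using z O' by (auto simp: A_def)
  qed
  moreover have "closedin (top_of_set H) A"
  proof -
    have "z \<in> A" if z: "z \<in> H" "z \<in> closure A" for z
    proof -
      have "z /\<^sub>R 1 \<in> H" using z by simp
      then obtain N J F where G: "radial_graph H N J F" "z \<in> N" "1 \<in> J" "F z = 1"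
        by (rule radial_graph_through[OF H zero_less_one]) (rule that)
      note F = radial_graphD[OF G(1)]
      obtain a where a: "\<And>i. a i \<in> A" "a \<longlonglongrightarrow> z"
        using z(2) by (auto simp: closure_sequential)
      have aL: "a i \<in> L" "a i \<in> H" "\<Phi> (a i) = 1" for i using a(1)[of i] by (auto simp: A_def)
      define u where "u i = frechet_derivative \<Phi> (at x) (a i) - 1" for i
      define l where "l i = 1 - frechet_derivative F (at (a i)) x" for i
      have "u \<longlonglongrightarrow> frechet_derivative \<Phi> (at x) z - 1"
        unfolding u_def by (intro tendsto_diff frechet_derivative_tendsto[OF L(1) C\<Phi> L(3)] tendsto_const a(2))
      moreover have "l \<longlonglongrightarrow> 1 - frechet_derivative F (at z) x"
        unfolding l_def by (intro tendsto_diff frechet_derivative_tendsto[OF F(1,3) G(2)] tendsto_const a(2))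
      ultimately have "Bseq u" "Bseq l" by (auto intro: convergent_imp_Bseq convergentI)
      then obtain Ku Kl where K: "\<And>i. \<bar>u i\<bar> \<le> Ku" "\<And>i. \<bar>l i\<bar> \<le> Kl"
        unfolding Bseq_def by auto
      define C where "C = max Ku Kl"
      have evN: "\<forall>\<^sub>F i in sequentially. a i \<in> N"
        using a(2) F(1) G(2) by (rule topological_tendstoD)
      have bound: "1 \<le> \<Phi> (x + t *\<^sub>R (a i - x)) \<and>
          \<bar>frechet_derivative \<Phi> (at (x + t *\<^sub>R (a i - x))) (a i - x)\<bar> \<le> C"
        if i: "a i \<in> N" and t: "0 \<le> t" "t \<le> 1" for i t
      proof -
        have J: "\<Phi> (a i) \<in> J" using aL G(3) by simp
        obtain O' where O': "open O'" "a i \<in> O'" "O' \<subseteq> N" "\<And>v. v \<in> O' \<Longrightarrow> v \<in> L \<Longrightarrow> \<Phi> v = F v"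
          by (rule radial_section_local[OF L(2) G(1) aL(1) i J]) (rule that)
        \<comment> \<open>Both sections have the value 1 at \<open>a i\<close>, so they have the same germ there.\<close>
        have "frechet_derivative \<Phi> (at (a i)) = frechet_derivative F (at (a i))"
          by (rule frechet_derivative_cong_open[of "O' \<inter> L"])
             (use O' L(1) aL(1) Ck_on_differentiable[OF F(3) i] in auto)
        then have "l i \<le> frechet_derivative \<Phi> (at (x + t *\<^sub>R (a i - x))) (a i - x)"
          "frechet_derivative \<Phi> (at (x + t *\<^sub>R (a i - x))) (a i - x) \<le> u i"
          "1 \<le> \<Phi> (x + t *\<^sub>R (a i - x))"
          using radial_section_segment[OF assms(1) L(1,2) star[OF aL(1)] L(4) aL(3) t, of i]
          by (simp_all add: l_def u_def)
        then show ?thesis using K[of i] unfolding C_def by linarith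
      qed
      have "z \<in> L"
      proof (rule radial_section_reaches_limit[OF assms(1,2) L(1-4), of z C])
        show "closed_segment x v \<subseteq> L" if "v \<in> L" for v using that by (rule star)
        show "S \<subseteq> L" if "open S" "convex S" "x \<in> S" "radial_section H S \<Psi>" "\<Psi> x = 1" for S \<Psi>
          using that by (rule max)
        fix t :: real assume t: "0 \<le> t" "t < 1" and pL: "x + t *\<^sub>R (z - x) \<in> L"
        have lim: "(\<lambda>i. x + t *\<^sub>R (a i - x)) \<longlonglongrightarrow> x + t *\<^sub>R (z - x)"
          by (intro tendsto_intros a(2))
        have ev: "\<forall>\<^sub>F i in sequentially. 1 \<le> \<Phi> (x + t *\<^sub>R (a i - x)) \<and>
            \<bar>frechet_derivative \<Phi> (at (x + t *\<^sub>R (a i - x))) (a i - x)\<bar> \<le> C"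
          using evN by eventually_elim (use bound t in auto)
        have "isCont \<Phi> (x + t *\<^sub>R (z - x))"
          using cont L(1) pL continuous_on_eq_continuous_at by blast
        then have "(\<lambda>i. \<Phi> (x + t *\<^sub>R (a i - x))) \<longlonglongrightarrow> \<Phi> (x + t *\<^sub>R (z - x))"
          using lim by (rule isCont_tendsto_compose)
        then have 1: "1 \<le> \<Phi> (x + t *\<^sub>R (z - x))"
          by (rule tendsto_lowerbound) (use ev in \<open>auto elim: eventually_mono\<close>)
        have "(\<lambda>i. \<bar>frechet_derivative \<Phi> (at (x + t *\<^sub>R (a i - x))) (a i - x)\<bar>)
            \<longlonglongrightarrow> \<bar>frechet_derivative \<Phi> (at (x + t *\<^sub>R (z - x))) (z - x)\<bar>"
          by (intro tendsto_rabs frechet_derivative_tendsto[OF L(1) C\<Phi> pL lim] tendsto_diff tendsto_const a(2))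
        then have 2: "\<bar>frechet_derivative \<Phi> (at (x + t *\<^sub>R (z - x))) (z - x)\<bar> \<le> C"
          by (rule tendsto_upperbound) (use ev in \<open>auto elim: eventually_mono\<close>)
        show "1 \<le> \<Phi> (x + t *\<^sub>R (z - x)) \<and> \<bar>frechet_derivative \<Phi> (at (x + t *\<^sub>R (z - x))) (z - x)\<bar> \<le> C"
          using 1 2 by blast
      qed
      then have "isCont \<Phi> z" using cont L(1) continuous_on_eq_continuous_at by blast
      then have "(\<lambda>i. \<Phi> (a i)) \<longlonglongrightarrow> \<Phi> z" using a(2) by (rule isCont_tendsto_compose)
      then have "\<Phi> z = 1" using aL(3) by (simp add: LIMSEQ_const_iff)
      then show ?thesis using \<open>z \<in> L\<close> z(1) by (simp add: A_def)
    qed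
    moreover have "A \<subseteq> H" by (auto simp: A_def)
    ultimately have "A = H \<inter> closure A" using closure_subset by blast
    then show ?thesis by (metis closed_closure closedin_closed_Int)
  qed
  ultimately have "A = {} \<or> A = H" using assms(3) by (simp add: connected_clopen)
  moreover have "x \<in> A" using L assms(4) by (simp add: A_def)
  ultimately have "y \<in> A" using assms(5) by blast
  then show ?thesis using that[OF L(1) star L(2,4)] by (simp add: A_def)
qed

section \<open>The cone over the hypersurface\<close>

text \<open>
  A convex combination of \<open>r x\<close> and \<open>s y\<close> is a positive multiple of a point of the segment from \<open>x\<close> to
  \<open>y\<close>, and the section over this segment places that point in the cone.
\<close>

lemma centroaffine_cone_convex:
  assumes "hyperbolic_centroaffine_hypersurface H" "euclidean_complete H" "connected H"
  shows "convex (cone_over H)"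
  unfolding convex_alt
proof (intro ballI allI impI)
  fix p q :: 'a and t :: real
  assume "p \<in> cone_over H" "q \<in> cone_over H" and t: "0 \<le> t \<and> t \<le> 1"
  then obtain r x s y where p: "p = r *\<^sub>R x" "0 < r" "x \<in> H" and q: "q = s *\<^sub>R y" "0 < s" "y \<in> H"
    unfolding cone_over_def by blast
  define k where "k = (1 - t) * r + t * s"
  have "0 < k"
  proof (cases "t = 0")
    case False
    then have "0 < t * s" "0 \<le> (1 - t) * r" using t p q by auto
    then show ?thesis by (simp add: k_def)
  qed (use p in \<open>simp add: k_def\<close>)
  define z where "z = ((1 - t) *\<^sub>R p + t *\<^sub>R q) /\<^sub>R k"
  obtain S \<Psi> where S: "closed_segment x y \<subseteq> S" "radial_section H S \<Psi>"
    by (rule radial_section_joins_points[OF assms p(3) q(3)]) (rule that)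
  have coeff: "1 - t * s / k = (1 - t) * r / k" using \<open>0 < k\<close> by (simp add: field_simps k_def)
  have "z = (1 - t * s / k) *\<^sub>R x + (t * s / k) *\<^sub>R y"
    unfolding coeff using p q by (simp add: z_def scaleR_add_right divide_inverse mult_ac)
  moreover have "t * s / k \<le> 1" "0 \<le> t * s / k"
    using t p q \<open>0 < k\<close> by (simp_all add: k_def)
  ultimately have "z \<in> closed_segment x y" unfolding in_segment by blast
  then have "z \<in> S" using S(1) by blast
  then have "0 < k * \<Psi> z" "z /\<^sub>R \<Psi> z \<in> H" "0 < \<Psi> z"
    using S(2) \<open>0 < k\<close> by (auto simp: radial_section_def)
  moreover have "(1 - t) *\<^sub>R p + t *\<^sub>R q = (k * \<Psi> z) *\<^sub>R (z /\<^sub>R \<Psi> z)"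
  proof -
    have "(k * \<Psi> z) *\<^sub>R (z /\<^sub>R \<Psi> z) = k *\<^sub>R z" using \<open>0 < \<Psi> z\<close> by simp
    then show ?thesis using \<open>0 < k\<close> by (simp add: z_def)
  qed
  ultimately show "(1 - t) *\<^sub>R p + t *\<^sub>R q \<in> cone_over H"
    unfolding cone_over_def by blast
qed

text \<open>
  The section joining \<open>x\<close> to \<open>c x\<close> has the value 1 at both points. By uniqueness it coincides over the
  segment \<open>K\<close> with the section \<open>u x \<mapsto> u\<close>, written as \<open>q \<mapsto> |q| / |x|\<close>, whose value at \<open>c x\<close> is \<open>c\<close>.
\<close>

lemma centroaffine_ray_inject:
  assumes "hyperbolic_centroaffine_hypersurface H" "euclidean_complete H" "connected H"
    and "x \<in> H" "c *\<^sub>R x \<in> H" "0 < c"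
  shows "c = 1"
proof -
  have H: "centroaffine_hypersurface H"
    by (rule hyperbolic_imp_centroaffine[OF assms(1)])
  obtain S \<Psi> where S: "closed_segment x (c *\<^sub>R x) \<subseteq> S" "radial_section H S \<Psi>" "\<Psi> x = 1" "\<Psi> (c *\<^sub>R x) = 1"
    by (rule radial_section_joins_points[OF assms(1-5)]) (rule that)
  have x0: "x \<noteq> 0" by (rule centroaffine_nonzero[OF H assms(4)])
  define K where "K = (\<lambda>u. u *\<^sub>R x) ` closed_segment 1 c"
  have ray: "norm (u *\<^sub>R x) / norm x = u" if "0 < u" for u
    using that x0 by simp
  have pos: "0 < u" if "u \<in> closed_segment 1 c" for u
    using that assms(6) by (auto simp: closed_segment_eq_real_ivl split: if_splits)
  have "K = closed_segment (1 *\<^sub>R x) (c *\<^sub>R x)"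
    unfolding K_def
    by (rule closed_segment_linear_image[symmetric]) (simp add: bounded_linear.linear bounded_linear_scaleR_left)
  then have sec: "radial_section H K \<Psi>" using S by (auto intro: radial_section_subset)
  have "radial_section H K (\<lambda>q. norm q / norm x)"
    unfolding radial_section_def
  proof (intro conjI ballI)
    show "continuous_on K (\<lambda>q. norm q / norm x)" using x0 by (intro continuous_intros) auto
    fix q assume "q \<in> K"
    then obtain u where u: "q = u *\<^sub>R x" "0 < u" using pos by (auto simp: K_def)
    then have eq: "norm q / norm x = u" using ray by simp
    show "0 < norm q / norm x" "q /\<^sub>R (norm q / norm x) \<in> H"
      unfolding eq using u assms(4) by simp_all
  qed
  moreover have "connected K"
    unfolding K_def by (intro connected_continuous_image continuous_intros) auto
  moreover have "1 *\<^sub>R x \<in> K" "c *\<^sub>R x \<in> K"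
    unfolding K_def by (intro imageI ends_in_segment)+
  moreover have "\<Psi> x = norm x / norm x" using S(3) x0 by simp
  ultimately have "\<Psi> (c *\<^sub>R x) = norm (c *\<^sub>R x) / norm x"
    using radial_section_unique[OF H _ sec, of "\<lambda>q. norm q / norm x" x "c *\<^sub>R x"] by simp
  then show ?thesis using S(4) ray[OF assms(6)] by simp
qed

text \<open>
  The domain of a radial graph lies in the cone.
\<close>

lemma open_cone_over:
  assumes "centroaffine_hypersurface H"
  shows "open (cone_over H)"
proof (subst open_subopen, intro ballI)
  fix q assume "q \<in> cone_over H"
  then obtain r x where "q = r *\<^sub>R x" "0 < r" "x \<in> H" by (auto simp: cone_over_def)
  then have "0 < r" "q /\<^sub>R r \<in> H" by simp_all
  then obtain N J F where G: "radial_graph H N J F" "q \<in> N"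
    by (rule radial_graph_through[OF assms]) (rule that)
  have "N \<subseteq> cone_over H"
  proof
    fix z assume "z \<in> N"
    then have "0 < F z" "z /\<^sub>R F z \<in> H"
      using radial_graph_section[OF G(1)] by (auto simp: radial_section_def)
    moreover from this have "z = F z *\<^sub>R (z /\<^sub>R F z)" by simp
    ultimately show "z \<in> cone_over H" unfolding cone_over_def by blast
  qed
  then show "\<exists>T. open T \<and> q \<in> T \<and> T \<subseteq> cone_over H" using radial_graphD(1)[OF G(1)] G(2) by blast
qed

text \<open>
  Once every ray meets \<open>H\<close> at most once, the cone map is injective, and near each point its inverse must be
  \<open>q \<mapsto> (F q, q / F q)\<close> for a radial graph \<open>F\<close>.
\<close>

lemma centroaffine_polar_diffeomorphism:
  fixes H :: "'a::euclidean_space set"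
  assumes "centroaffine_hypersurface H"
    and ray: "\<And>x c. x \<in> H \<Longrightarrow> c *\<^sub>R x \<in> H \<Longrightarrow> 0 < c \<Longrightarrow> c = 1"
  shows "diffeomorphism_on ({0<..} \<times> H) (cone_over H) (\<lambda>(r::real, x). r *\<^sub>R x)"
proof -
  define \<phi> where "\<phi> = (\<lambda>(r::real, x::'a). r *\<^sub>R x)"
  define \<theta> where "\<theta> = inv_into ({0<..} \<times> H) \<phi>"
  have unique: "r = s \<and> x = y" if "0 < r" "0 < s" "x \<in> H" "y \<in> H" "r *\<^sub>R x = s *\<^sub>R y" for r s x y
  proof -
    have "(1 / s) *\<^sub>R (r *\<^sub>R x) = y" unfolding that(5) using that(2) by simp
    then have y: "y = (r / s) *\<^sub>R x" by simp
    then have "r / s = 1" using that by (intro ray[OF that(3)]) simp_all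
    then show ?thesis using y that(2) by simp
  qed
  have inj: "inj_on \<phi> ({0<..} \<times> H)"
    using unique by (auto simp: inj_on_def \<phi>_def)
  have image: "\<phi> ` ({0<..} \<times> H) = cone_over H"
    by (auto simp: \<phi>_def cone_over_def image_iff)
  have "smooth_on ({0<..} \<times> H) \<phi>"
    unfolding smooth_on_def
  proof (intro ballI)
    fix z :: "real \<times> 'a" assume "z \<in> {0<..} \<times> H"
    have "Ck_on k UNIV \<phi>" for k
      unfolding \<phi>_def case_prod_beta
      by (intro Ck_on_scaleR Ck_on_linear bounded_linear_fst bounded_linear_snd open_UNIV)
    then show "\<exists>V F. open V \<and> z \<in> V \<and> (\<forall>k. Ck_on k V F) \<and> (\<forall>x\<in>V \<inter> ({0<..} \<times> H). F x = \<phi> x)"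
      by (intro exI[of _ UNIV] exI[of _ \<phi>]) auto
  qed
  moreover have "smooth_on (cone_over H) \<theta>"
    unfolding smooth_on_def
  proof (intro ballI)
    fix q assume "q \<in> cone_over H"
    then obtain r x where "q = r *\<^sub>R x" "0 < r" "x \<in> H" by (auto simp: cone_over_def)
    then have "0 < r" "q /\<^sub>R r \<in> H" by simp_all
    then obtain N J F where G: "radial_graph H N J F" "q \<in> N"
      by (rule radial_graph_through[OF assms(1)]) (rule that)
    note F = radial_graphD[OF G(1)]
    have sec: "0 < F z" "z /\<^sub>R F z \<in> H" if "z \<in> N" for z
      using radial_graph_section[OF G(1)] that by (auto simp: radial_section_def)
    have "Ck_on k N (\<lambda>z. (F z, z /\<^sub>R F z))" for k
      by (intro Ck_on_Pair Ck_on_scaleR Ck_on_inverse F(1,3) Ck_on_linear[OF bounded_linear_ident])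
         (use sec in force)
    moreover have "(F z, z /\<^sub>R F z) = \<theta> z" if "z \<in> N" for z
    proof -
      have "\<phi> (F z, z /\<^sub>R F z) = z" using sec[OF that] by (simp add: \<phi>_def)
      then show ?thesis
        using inv_into_f_f[OF inj, of "(F z, z /\<^sub>R F z)"] sec[OF that] by (simp add: \<theta>_def)
    qed
    ultimately show "\<exists>V F. open V \<and> q \<in> V \<and> (\<forall>k. Ck_on k V F) \<and> (\<forall>x\<in>V \<inter> cone_over H. F x = \<theta> x)"
      using F(1) G(2) by (intro exI[of _ N] exI[of _ "\<lambda>z. (F z, z /\<^sub>R F z)"]) auto
  qed
  ultimately show ?thesis
    unfolding diffeomorphism_on_def bij_betw_def \<phi>_def[symmetric] \<theta>_def[symmetric]
    using inj image by blast
qed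

theorem proposition1p10:
  fixes n :: nat and H :: "(real ^ 'm) set"
  assumes "1 \<le> n" and "CARD('m) = n + 1"
    and "hyperbolic_centroaffine_hypersurface H"
    and "connected H"
    and "euclidean_complete H"
  shows "open (cone_over H) \<and> convex (cone_over H) \<and>
    diffeomorphism_on ({0<..} \<times> H) (cone_over H) (\<lambda>(r::real, x). r *\<^sub>R x)"
proof (intro conjI)
  have H: "centroaffine_hypersurface H"
    by (rule hyperbolic_imp_centroaffine[OF assms(3)])
  show "open (cone_over H)" by (rule open_cone_over[OF H])
  show "convex (cone_over H)" by (rule centroaffine_cone_convex[OF assms(3,5,4)])
  show "diffeomorphism_on ({0<..} \<times> H) (cone_over H) (\<lambda>(r::real, x). r *\<^sub>R x)"
    by (rule centroaffine_polar_diffeomorphism[OF H centroaffine_ray_inject[OF assms(3,5,4)]])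
qed

end
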